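(* Let $\mu$ be a symmetric Dyck path of length $2n$ such that $\mu^+$ has $k$ unmatched up steps. Then $$\sum_{D\in\mathcal{D}_{\mathrm{sym}}( */\mu)} q^{\mathrm{tiles}_+(D)+\mathrm{tiles}_0(D)} t^{\mathrm{tiles}_0(D)} = f_k(q,t) \prod_{u\in\mathrm{UP}(\mu^+)} [\mathrm{ht}(u)]_q,$$ where $\mathrm{UP}(\mu^+)$ is the set of matched up steps in $\mu^+$ and $f_k(q,t)$ is defined by $f_0(q,t)=f_1(q,t)=1$ and $f_k(q,t)=f_{k-1}(q,t)+tq[k-1]_q f_{k-2}(q,t)$ for $k\ge2$.
   Context: A Dyck path of length $2n$ is a lattice path of up steps $(0,1)$ and down steps $(1,0)$ from $(0,0)$ to $(n,n)$ never going strictly below $y=x$; it is symmetric if it is invariant under the reflection along the line $x+y=n$ (the center line). For a symmetric Dyck path $\mu$ of length $2n$, $\mu^+$ is the subpath formed by its first $n$ steps. Each up step of a Dyck path is matched with a unique down step; an up step of $\mu^+$ is called matched if its corresponding down step in $\mu$ lies in $\mu^+$, and unmatched otherwise. The height $\mathrm{ht}(u)$ of an up step $u$ is $1$ plus the number of squares between $u$ and the line $y=x$ (so $\mathrm{ht}(u)=b-a+1$ if $u$ starts at $(a,b)$). $[m]_q=1+q+\cdots+q^{m-1}$. Cells are unit squares with integer corners. A Dyck tile is a ribbon (finite set of cells) such that the centers of its cells are the lattice points of a translate of a Dyck path (length $0$ allowed, giving a single cell). For Dyck paths $\lambda,\mu$ of length $2n$ with $\mu$ weakly above $\lambda$, a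 Dyck tiling of $\lambda/\mu$ is a tiling $D$ by Dyck tiles of the region between $\lambda$ and $\mu$ such that if $\eta$ is a tile of $D$, then the translate of $\eta$ by $(1,-1)$ is either completely below $\lambda$ or contained in another tile of $D$. For symmetric $\lambda,\mu$, it is symmetric if it is invariant under the reflection along $x+y=n$. $\mathcal{D}_{\mathrm{sym}}( */\mu)$ is the set of symmetric Dyck tilings with fixed upper path $\mu$ and arbitrary symmetric lower path. $\mathrm{tiles}_+(D)$ is the number of tiles strictly to the left of the center line and $\mathrm{tiles}_0(D)$ is the number of tiles that intersect the center line. *)

theory Defs
  imports Complex_Main "HOL-Library.Disjoint_Sets"
begin

section \<open>Dyck paths\<close>

datatype step = Up | Down

text \<open>Lattice point reached after the first \<open>i\<close> steps, starting at the origin;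
  an up step is \<open>(0,1)\<close> and a down step is \<open>(1,0)\<close>.\<close>

definition pt :: "step list \<Rightarrow> nat \<Rightarrow> int \<times> int" where
  "pt w i = (int (count_list (take i w) Down), int (count_list (take i w) Up))"

definition lattice_points :: "step list \<Rightarrow> (int \<times> int) set" where
  "lattice_points w = pt w ` {0..length w}"

text \<open>Dyck paths of length \<open>2 * n\<close>.\<close>

definition dyck_path :: "nat \<Rightarrow> step list \<Rightarrow> bool" where
  "dyck_path n w \<longleftrightarrow>
     length w = 2 * n \<and> pt w (2 * n) = (int n, int n) \<and>
     (\<forall>i\<le>2 * n. fst (pt w i) \<le> snd (pt w i))"

fun reflect_point :: "nat \<Rightarrow> int \<times> int \<Rightarrow> int \<times> int" where
  "reflect_point n (x, y) = (int n - y, int n - x)"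

text \<open>A lattice path is determined by its set of lattice points, so invariance of that set
  is invariance of the path.\<close>

definition sym_dyck_path :: "nat \<Rightarrow> step list \<Rightarrow> bool" where
  "sym_dyck_path n w \<longleftrightarrow>
     dyck_path n w \<and> reflect_point n ` lattice_points w = lattice_points w"

definition weakly_above :: "nat \<Rightarrow> step list \<Rightarrow> step list \<Rightarrow> bool" where
  "weakly_above n \<mu> lam \<longleftrightarrow> (\<forall>i\<le>2 * n. snd (pt lam i) \<le> snd (pt \<mu> i))"

text \<open>The up step at position \<open>i\<close> is matched with the down step at position \<open>j\<close> iff the
  steps strictly between them form a (possibly empty) Dyck path.\<close>

definition matching_steps :: "step list \<Rightarrow> nat \<Rightarrow> nat \<Rightarrow> bool" where
  "matching_steps w i j \<longleftrightarrow>
     i < j \<and> j < length w \<and> w ! i = Up \<and> w ! j = Down \<and>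
     (\<exists>m. dyck_path m (take (j - Suc i) (drop (Suc i) w)))"

text \<open>Steps are referred to by their positions \<open>0, 1, \<dots>\<close>; the subpath \<open>\<mu>\<^sup>+\<close> consists of
  the positions less than \<open>n\<close>.\<close>

definition matched_ups :: "nat \<Rightarrow> step list \<Rightarrow> nat set" where
  "matched_ups n \<mu> = {i. i < n \<and> \<mu> ! i = Up \<and> (\<exists>j<n. matching_steps \<mu> i j)}"

definition unmatched_ups :: "nat \<Rightarrow> step list \<Rightarrow> nat set" where
  "unmatched_ups n \<mu> = {i. i < n \<and> \<mu> ! i = Up \<and> \<not> (\<exists>j<n. matching_steps \<mu> i j)}"

text \<open>The height \<open>b - a + 1\<close> of an up step starting at \<open>(a, b)\<close>.\<close>

definition ht :: "step list \<Rightarrow> nat \<Rightarrow> nat" where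
  "ht w i = nat (snd (pt w i) - fst (pt w i) + 1)"

section \<open>Dyck tilings\<close>

text \<open>The cell \<open>[a, a + 1] \<times> [b, b + 1]\<close> is encoded by its lower left corner \<open>(a, b)\<close>. It lies
  below (above) a path if it lies below (above) the down step of the path from \<open>x = a\<close>
  to \<open>x = a + 1\<close>.\<close>

type_synonym cell = "int \<times> int"

fun cell_below :: "step list \<Rightarrow> cell \<Rightarrow> bool" where
  "cell_below w (a, b) \<longleftrightarrow>
     (\<exists>i<length w. w ! i = Down \<and> fst (pt w i) = a \<and> b + 1 \<le> snd (pt w i))"

fun cell_above :: "step list \<Rightarrow> cell \<Rightarrow> bool" where
  "cell_above w (a, b) \<longleftrightarrow>
     (\<exists>i<length w. w ! i = Down \<and> fst (pt w i) = a \<and> snd (pt w i) \<le> b)"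

definition region :: "step list \<Rightarrow> step list \<Rightarrow> cell set" where
  "region lam \<mu> = {c. cell_above lam c \<and> cell_below \<mu> c}"

fun shift :: "int \<times> int \<Rightarrow> cell \<Rightarrow> cell" where
  "shift (x, y) (a, b) = (a + x, b + y)"

text \<open>Centers and lower left corners differ by the fixed vector \<open>(1/2, 1/2)\<close>, so the cell
  centers form a translate of a Dyck path iff the corners do. Such a set of cells is
  automatically a ribbon.\<close>

definition dyck_tile :: "cell set \<Rightarrow> bool" where
  "dyck_tile \<eta> \<longleftrightarrow> (\<exists>m w v. dyck_path m w \<and> \<eta> = shift v ` lattice_points w)"

definition dyck_tiling :: "nat \<Rightarrow> step list \<Rightarrow> step list \<Rightarrow> cell set set \<Rightarrow> bool" where
  "dyck_tiling n lam \<mu> D \<longleftrightarrow>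
     dyck_path n lam \<and> dyck_path n \<mu> \<and> weakly_above n \<mu> lam \<and>
     partition_on (region lam \<mu>) D \<and> (\<forall>\<eta>\<in>D. dyck_tile \<eta>) \<and>
     (\<forall>\<eta>\<in>D. (\<forall>c \<in> shift (1, -1) ` \<eta>. cell_below lam c) \<or>
             (\<exists>\<eta>'\<in>D. \<eta>' \<noteq> \<eta> \<and> shift (1, -1) ` \<eta> \<subseteq> \<eta>'))"

text \<open>The reflection along \<open>x + y = n\<close>, sending lower left corners of cells to lower left corners
  of the reflected cells.\<close>

fun reflect_cell :: "nat \<Rightarrow> cell \<Rightarrow> cell" where
  "reflect_cell n (a, b) = (int n - b - 1, int n - a - 1)"

definition sym_dyck_tiling :: "nat \<Rightarrow> step list \<Rightarrow> step list \<Rightarrow> cell set set \<Rightarrow> bool" where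
  "sym_dyck_tiling n lam \<mu> D \<longleftrightarrow>
     sym_dyck_path n lam \<and> sym_dyck_path n \<mu> \<and> dyck_tiling n lam \<mu> D \<and>
     (\<lambda>\<eta>. reflect_cell n ` \<eta>) ` D = D"

text \<open>A tiling determines its region and hence, given \<open>\<mu>\<close>, its lower path; so no tiling is
  identified with another one by forgetting the lower path.\<close>

definition sym_dyck_tilings :: "nat \<Rightarrow> step list \<Rightarrow> cell set set set" where
  "sym_dyck_tilings n \<mu> = {D. \<exists>lam. sym_dyck_tiling n lam \<mu> D}"

text \<open>On the cell \<open>(a, b)\<close> the function \<open>x + y\<close> ranges over \<open>[a + b, a + b + 2]\<close>. A tile is left of
  the center line if its interior is, and intersects the center line if the line passes
  through the interior of one of its cells; merely touching the line in a corner of a cell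
  does not count (a tile can touch its mirror image in such a corner without being symmetric).\<close>

definition tiles_plus :: "nat \<Rightarrow> cell set set \<Rightarrow> nat" where
  "tiles_plus n D = card {\<eta> \<in> D. \<forall>(a, b) \<in> \<eta>. a + b + 2 \<le> int n}"

definition tiles_zero :: "nat \<Rightarrow> cell set set \<Rightarrow> nat" where
  "tiles_zero n D = card {\<eta> \<in> D. \<exists>(a, b) \<in> \<eta>. a + b < int n \<and> int n < a + b + 2}"

section \<open>The generating functions\<close>

definition qint :: "'a::comm_ring_1 \<Rightarrow> nat \<Rightarrow> 'a" where
  "qint q m = (\<Sum>i<m. q ^ i)"

fun fk :: "nat \<Rightarrow> 'a::comm_ring_1 \<Rightarrow> 'a \<Rightarrow> 'a" where
  "fk 0 q t = 1"
| "fk (Suc 0) q t = 1"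
| "fk (Suc (Suc k)) q t = fk (Suc k) q t + t * q * qint q (Suc k) * fk k q t"

section \<open>Finiteness\<close>

text \<open>The sum over all symmetric Dyck tilings is a finite sum, and hence not zero by convention.\<close>

lemma finite_region: "finite (region lam \<mu>)"
proof (rule finite_subset)
  let ?S = "\<lambda>(i, j). {fst (pt \<mu> j)} \<times> {snd (pt lam i)..snd (pt \<mu> j)}"
  show "region lam \<mu> \<subseteq> (\<Union>p \<in> {..<length lam} \<times> {..<length \<mu>}. ?S p)"
  proof
    fix c assume "c \<in> region lam \<mu>"
    moreover obtain a b where c: "c = (a, b)"
      by (cases c)
    ultimately obtain i j where "i < length lam" "snd (pt lam i) \<le> b"
      "j < length \<mu>" "fst (pt \<mu> j) = a" "b + 1 \<le> snd (pt \<mu> j)"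
      unfolding region_def by auto
    then show "c \<in> (\<Union>p \<in> {..<length lam} \<times> {..<length \<mu>}. ?S p)"
      unfolding c by (intro UN_I[of "(i, j)"]) auto
  qed
  show "finite (\<Union>p \<in> {..<length lam} \<times> {..<length \<mu>}. ?S p)"
    by auto
qed

lemma finite_sym_dyck_tilings: "finite (sym_dyck_tilings n \<mu>)"
proof (rule finite_subset)
  let ?L = "{lam. set lam \<subseteq> {Up, Down} \<and> length lam = 2 * n}"
  show "sym_dyck_tilings n \<mu> \<subseteq> (\<Union>lam\<in>?L. Pow (Pow (region lam \<mu>)))"
  proof
    fix D assume "D \<in> sym_dyck_tilings n \<mu>"
    then obtain lam where "length lam = 2 * n" and D: "\<Union>D = region lam \<mu>"
      by (auto simp: sym_dyck_tilings_def sym_dyck_tiling_def dyck_tiling_def dyck_path_def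
          partition_on_def)
    moreover have "set lam \<subseteq> {Up, Down}"
      using step.exhaust by auto
    ultimately have "lam \<in> ?L"
      by simp
    moreover have "D \<in> Pow (Pow (region lam \<mu>))"
      using D by blast
    ultimately show "D \<in> (\<Union>lam\<in>?L. Pow (Pow (region lam \<mu>)))"
      by (rule UN_I)
  qed
  have "finite ?L"
    by (rule finite_lists_length_eq) simp
  then show "finite (\<Union>lam\<in>?L. Pow (Pow (region lam \<mu>)))"
    by (rule finite_UN_I) (simp add: finite_region)
qed

end

theory Submission
  imports Defs
begin

text \<open>
  The theorem follows from a local rule at a peak of the upper path. Let \<open>c\<close> be the cell just below
  the peak. If \<open>c\<close> is a tile by itself, it can be removed, which turns the peak into a valley, and
  nothing else changes (\<open>remove_peak_tile\<close>, \<open>add_peak_tile\<close>). If it is not, then either the lower path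
  touches the peak or the tile of \<open>c\<close> contains both lower neighbours of \<open>c\<close>. Since a
  tile pushed by \<open>(1, -1)\<close> stays inside the next tile, all tiles on the diagonal of \<open>c\<close> then have
  a peak there (\<open>tile_through_peak_column\<close>), and so has the lower path. Deleting this peak from
  both paths and from all tiles that pass through it is a bijection onto the tilings whose upper path
  is the given one with the peak deleted (\<open>contract_peak\<close>, \<open>dyck_tiling_insert_peak\<close>). It keeps the number
  of tiles and their position relative to the center line.

  For a symmetric tiling this is done simultaneously at a peak and at its mirror image, or
  at the central peak alone. Write \<open>F w\<close> for the weighted sum over the symmetric tilings whose upper path has
  \<open>w\<close> as its first half. The two cases give
    \<open>F (x Up Down y) = q F (x Down Up y) + F (x y)\<close> and \<open>F (x Up) = t q F (x Down) + F x\<close>,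
  since a removed pair of tiles has weight \<open>q\<close> and a removed central tile has weight \<open>t q\<close>.
  Moreover \<open>F\<close> is 1 on the empty word and 0 on words that start with a down step. As every word with an
  up step either ends with one or contains a peak, \<open>F\<close> is determined by these equations.

  The right-hand side satisfies them too. In the first half, a down step that starts at height \<open>h\<close> is
  matched with an up step of height \<open>h\<close>, so the product runs over the heights at which the down
  steps start, and \<open>k\<close> is the height reached at the end. The first equation becomes
  \<open>[h + 1] = q [h] + 1\<close>, and the second one becomes the recurrence for \<open>fk\<close>.
\<close>

section \<open>Lattice paths and the number of up steps\<close>

text \<open>Integer indices let the same function be evaluated at the content of any cell; outside the
  path it is constant.\<close>

definition ups :: "step list \<Rightarrow> int \<Rightarrow> int" where
  "ups w i = int (count_list (take (nat i) w) Up)"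

lemma count_list_take_Suc:
  "i < length w \<Longrightarrow> count_list (take (Suc i) w) c = count_list (take i w) c + (if w ! i = c then 1 else 0)"
  by (simp add: take_Suc_conv_app_nth)

lemma count_Up_plus_Down: "count_list w Up + count_list w Down = length w"
proof (induction w)
  case (Cons s w)
  then show ?case by (cases s) auto
qed simp

lemma pt_ups: "i \<le> length w \<Longrightarrow> pt w i = (int i - ups w (int i), ups w (int i))"
  using count_Up_plus_Down[of "take i w"] by (simp add: pt_def ups_def)

lemma ups_nonpos [simp]: "i \<le> 0 \<Longrightarrow> ups w i = 0"
  by (simp add: ups_def)

lemma ups_beyond: "int (length w) \<le> i \<Longrightarrow> ups w i = ups w (int (length w))"
  by (simp add: ups_def)

lemma ups_step:
  assumes "0 \<le> i" "i < int (length w)"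
  shows "ups w (i + 1) = ups w i + (if w ! nat i = Up then 1 else 0)"
proof -
  have "nat (i + 1) = Suc (nat i)" "nat i < length w" using assms by auto
  then show ?thesis by (simp add: ups_def count_list_take_Suc)
qed

lemma ups_bounds: "ups w i \<le> ups w (i + 1)" "ups w (i + 1) \<le> ups w i + 1"
proof -
  consider "i < 0" | "0 \<le> i" "i < int (length w)" | "int (length w) \<le> i" by linarith
  then have "ups w i \<le> ups w (i + 1) \<and> ups w (i + 1) \<le> ups w i + 1"
  proof cases
    case 3
    then show ?thesis using ups_beyond[of w i] ups_beyond[of w "i+1"] by simp
  qed (auto simp: ups_step)
  then show "ups w i \<le> ups w (i + 1)" "ups w (i + 1) \<le> ups w i + 1" by auto
qed

lemma ups_mono_lipschitz:
  assumes "i \<le> j" shows "ups w i \<le> ups w j \<and> ups w j \<le> ups w i + (j - i)"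
  using assms
proof (induction j rule: int_ge_induct)
  case (step j)
  then show ?case using ups_bounds[where w = w and i = j] by linarith
qed simp

lemma ups_append:
  "ups (v @ w) i = (if i \<le> int (length v) then ups v i else ups v (int (length v)) + ups w (i - int (length v)))"
  by (auto simp: ups_def nat_diff_distrib')

lemma ups_Cons: "ups (s # w) i = (if i \<le> 0 then 0 else (if s = Up then 1 else 0) + ups w (i - 1))"
proof (cases "i \<le> 0")
  case False
  then have "nat i = Suc (nat (i - 1))" by simp
  then show ?thesis using False by (simp add: ups_def)
qed simp

text \<open>Everything below rests on two operations on words: inserting a peak \<open>Up # Down\<close>, and turning
  a peak into a valley. Their effect on Dyck paths, cells and tiles is read off from their effect
  on \<open>ups\<close>.\<close>

lemma ups_insert_peak:
  "ups (v @ Up # Down # w) i =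
     (if i \<le> int (length v) then ups (v @ w) i
      else if i = int (length v) + 1 then ups (v @ w) (i - 1) + 1
      else ups (v @ w) (i - 2) + 1)"
proof -
  consider "i \<le> int (length v)" | "i = int (length v) + 1" | "i = int (length v) + 2" | "int (length v) + 2 < i"
    by linarith
  then show ?thesis by cases (auto simp: ups_append ups_Cons diff_right_commute[of i 2])
qed

lemma ups_flip_peak:
  "ups (v @ Down # Up # w) i =
     ups (v @ Up # Down # w) i - (if i = int (length v) + 1 then 1 else 0)"
  by (simp add: ups_append ups_Cons)

lemma dyck_path_iff:
  "dyck_path n w \<longleftrightarrow> length w = 2 * n \<and> ups w (2 * int n) = int n \<and>
     (\<forall>i. 0 \<le> i \<and> i \<le> 2 * int n \<longrightarrow> i \<le> 2 * ups w i)"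
proof -
  have "(\<forall>i\<le>2*n. fst (pt w i) \<le> snd (pt w i)) \<longleftrightarrow>
     (\<forall>i. 0 \<le> i \<and> i \<le> 2 * int n \<longrightarrow> i \<le> 2 * ups w i)" if "length w = 2 * n"
  proof -
    have "(\<forall>i\<le>2*n. fst (pt w i) \<le> snd (pt w i)) \<longleftrightarrow> (\<forall>i\<le>2*n. int i \<le> 2 * ups w (int i))"
      using that by (intro all_cong) (auto simp: pt_ups)
    also have "\<dots> \<longleftrightarrow> (\<forall>i. 0 \<le> i \<and> i \<le> 2 * int n \<longrightarrow> i \<le> 2 * ups w i)"
    proof safe
      fix i assume "\<forall>i\<le>2*n. int i \<le> 2 * ups w (int i)" "0 \<le> i" "i \<le> 2 * int n"
      then show "i \<le> 2 * ups w i" by (elim allE[of _ "nat i"]) auto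
    qed auto
    finally show ?thesis .
  qed
  then show ?thesis
    by (auto simp: dyck_path_def pt_ups)
qed

lemma weakly_above_iff:
  assumes "length lam = 2 * n" "length \<mu> = 2 * n"
  shows "weakly_above n \<mu> lam \<longleftrightarrow> (\<forall>i. ups lam i \<le> ups \<mu> i)"
proof
  assume *: "weakly_above n \<mu> lam"
  show "\<forall>i. ups lam i \<le> ups \<mu> i"
  proof
    fix i :: int
    define j where "j = nat (min (max i 0) (2 * int n))"
    have "j \<le> 2 * n" unfolding j_def by auto
    then have "ups lam (int j) \<le> ups \<mu> (int j)"
      using * assms by (auto simp: weakly_above_def pt_ups)
    moreover have "ups w i = ups w (int j)" if "length w = 2 * n" for w
      using ups_beyond[of w i] that by (cases "i \<le> 2 * int n") (auto simp: j_def min_def max_def)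
    ultimately show "ups lam i \<le> ups \<mu> i" using assms by simp
  qed
qed (use assms in \<open>auto simp: weakly_above_def pt_ups\<close>)

lemma mem_lattice_points:
  "(x, y) \<in> lattice_points w \<longleftrightarrow> 0 \<le> x + y \<and> x + y \<le> int (length w) \<and> y = ups w (x + y)"
proof
  assume "(x, y) \<in> lattice_points w"
  then obtain i where "i \<le> length w" "(x, y) = pt w i" by (auto simp: lattice_points_def)
  then show "0 \<le> x + y \<and> x + y \<le> int (length w) \<and> y = ups w (x + y)" by (simp add: pt_ups)
next
  assume *: "0 \<le> x + y \<and> x + y \<le> int (length w) \<and> y = ups w (x + y)"
  then have "(x, y) = pt w (nat (x + y))" by (simp add: pt_ups nat_le_iff)
  then show "(x, y) \<in> lattice_points w"
    unfolding lattice_points_def using * by (auto simp: image_iff nat_le_iff intro!: bexI[of _ "nat (x+y)"])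
qed

section \<open>Cells measured along their diagonals\<close>

text \<open>The content \<open>a + b\<close> of a cell \<open>(a, b)\<close> names the diagonal, in direction \<open>(1, -1)\<close>, on which it
  lies. The diagonal passes through the upper left and lower right corners of its cells, whose
  coordinates have sum \<open>a + b + 1\<close>, so a path crosses it at its point number \<open>a + b + 1\<close>. The depth counts
  cells along the diagonal from the path: the cell just below the path has depth 1, the one just
  above it has depth 0.\<close>

definition depth :: "step list \<Rightarrow> cell \<Rightarrow> int" where
  "depth w c = ups w (fst c + snd c + 1) - snd c"

lemma cell_below_above_depth:
  assumes "dyck_path n w" "0 \<le> a" "a < int n"
  shows "0 \<le> b \<Longrightarrow> cell_below w (a, b) \<longleftrightarrow> 0 < depth w (a, b)"
    and "0 \<le> b \<Longrightarrow> cell_above w (a, b) \<longleftrightarrow> depth w (a, b) \<le> 0"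
proof -
  have len: "length w = 2 * n" and top: "ups w (2 * int n) = int n"
    using assms by (auto simp: dyck_path_iff)
  \<comment> \<open>The last point with at most \<open>a\<close> down steps before it is where the unique down step
    from \<open>x = a\<close> to \<open>x = a + 1\<close> starts.\<close>
  let ?P = "\<lambda>i. i \<le> 2 * n \<and> int i - ups w (int i) \<le> a"
  have "?P 0" using assms by simp
  then obtain i where i: "?P i" "\<And>j. ?P j \<Longrightarrow> j \<le> i"
    using Nat.ex_has_greatest_nat[of ?P 0 "2 * n"] by auto
  have "i \<noteq> 2 * n" using i(1) top assms by auto
  then have "i < length w" using i(1) len by simp
  moreover have "a < int (Suc i) - ups w (int (Suc i))"
    using i(2)[of "Suc i"] \<open>i < length w\<close> len by (auto simp: not_le[symmetric])
  ultimately have d: "w ! i = Down" "int i - ups w (int i) = a"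
    using ups_step[of "int i" w] i(1) \<open>i < length w\<close>
    by (cases "w ! i"; simp add: add.commute)+
  have uniq: "j = i" if "j < length w" "w ! j = Down" "fst (pt w j) = a" for j
  proof -
    have "j \<le> i" using that len by (intro i(2)) (auto simp: pt_ups)
    moreover have False if "j < i"
    proof -
      have "ups w (int j + 1) = ups w (int j)" 
        using ups_step[of "int j" w] \<open>j < length w\<close> \<open>w ! j = Down\<close> by simp
      moreover have "ups w (int i) \<le> ups w (int j + 1) + (int i - (int j + 1))"
        using ups_mono_lipschitz[of "int j + 1" "int i" w] that by auto
      ultimately show False 
        using d \<open>fst (pt w j) = a\<close> \<open>j < length w\<close> by (simp add: pt_ups)
    qed
    ultimately show ?thesis by (meson le_neq_implies_less)
  qed
  have ex: "(\<exists>j<length w. w ! j = Down \<and> fst (pt w j) = a \<and> Q j) \<longleftrightarrow> Q i" for Q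
  proof -
    have "fst (pt w i) = a" using d \<open>i < length w\<close> by (simp add: pt_ups)
    then show ?thesis using uniq d(1) \<open>i < length w\<close> by blast
  qed
  have key: "b + 1 \<le> ups w (int i) \<longleftrightarrow> b < ups w (a + b + 1)"
  proof
    assume "b + 1 \<le> ups w (int i)"
    then show "b < ups w (a + b + 1)"
      using ups_mono_lipschitz[of "a + b + 1" "int i" w] d by auto
  next
    assume *: "b < ups w (a + b + 1)"
    show "b + 1 \<le> ups w (int i)"
    proof (rule ccontr)
      assume "\<not> b + 1 \<le> ups w (int i)"
      then have "int i \<le> a + b" using d by auto
      then have "ups w (a + b + 1) \<le> ups w (int i + 1) + (a + b - int i)"
        using ups_mono_lipschitz[of "int i + 1" "a + b + 1" w] by auto
      then show False using * d ups_step[of "int i" w] \<open>i < length w\<close> by simp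
    qed
  qed
  show "cell_below w (a, b) \<longleftrightarrow> 0 < depth w (a, b)"
    unfolding cell_below.simps ex depth_def using \<open>i < length w\<close> key by (simp add: pt_ups)
  show "cell_above w (a, b) \<longleftrightarrow> depth w (a, b) \<le> 0"
    unfolding cell_above.simps ex depth_def using \<open>i < length w\<close> key by (auto simp: pt_ups)
qed

text \<open>The depth conditions bound the coordinates by themselves: beyond the ends of the paths the
  values of \<open>ups\<close> agree, and in between a Dyck path confines the cells to the square of side \<open>n\<close>.\<close>

lemma region_depth:
  assumes "dyck_path n lam" "dyck_path n \<mu>"
  shows "region lam \<mu> = {c. depth lam c \<le> 0 \<and> 0 < depth \<mu> c}"
    and "(a, b) \<in> region lam \<mu> \<Longrightarrow> 0 \<le> a \<and> a + 1 < int n \<and> 1 \<le> b"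
proof -
  have bnd: "0 \<le> a \<and> a + 1 < int n \<and> 1 \<le> b" if "depth lam (a, b) \<le> 0" "0 < depth \<mu> (a, b)" for a b
  proof -
    let ?i = "a + b + 1"
    have len: "length lam = 2 * n" "length \<mu> = 2 * n" and 
      top: "ups lam (2 * int n) = int n" "ups \<mu> (2 * int n) = int n"
      using assms by (auto simp: dyck_path_iff)
    have le: "ups lam ?i \<le> b" "b < ups \<mu> ?i" using that by (auto simp: depth_def)
    have "0 < ?i" using le by (intro linorder_not_le[THEN iffD1] notI) simp
    moreover have "?i < 2 * int n"
      using le ups_beyond[of lam ?i] ups_beyond[of \<mu> ?i] len top by (intro linorder_not_le[THEN iffD1] notI) simp
    ultimately have "?i \<le> 2 * ups lam ?i" using assms by (auto simp: dyck_path_iff)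
    moreover have "ups \<mu> ?i \<le> ?i"
      using ups_mono_lipschitz[of 0 ?i \<mu>] \<open>0 < ?i\<close> by auto
    moreover have "ups \<mu> ?i \<le> int n" 
      using ups_mono_lipschitz[of ?i "2 * int n" \<mu>] \<open>?i < _\<close> top by auto
    moreover note le
    ultimately show ?thesis by linarith
  qed
  show eq: "region lam \<mu> = {c. depth lam c \<le> 0 \<and> 0 < depth \<mu> c}"
  proof safe
    fix a b assume "(a, b) \<in> region lam \<mu>"
    then have ab: "cell_above lam (a, b)" "cell_below \<mu> (a, b)" by (auto simp: region_def)
    then obtain i where i: "i < length lam" "lam ! i = Down" "fst (pt lam i) = a" "snd (pt lam i) \<le> b"
      by auto
    have "0 \<le> a" "0 \<le> b" using i(3,4) by (auto simp: pt_def)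
    moreover have "a < int n"
    proof -
      have "ups lam (int i + 1) = ups lam (int i)" using i ups_step[of "int i" lam] by simp
      moreover have "ups lam (2 * int n) \<le> ups lam (int i + 1) + (2 * int n - (int i + 1))"
        using ups_mono_lipschitz[of "int i + 1" "2 * int n" lam] i assms by (auto simp: dyck_path_iff)
      ultimately show ?thesis using i assms by (auto simp: dyck_path_iff pt_ups)
    qed
    ultimately show "depth lam (a, b) \<le> 0" "0 < depth \<mu> (a, b)"
      using ab cell_below_above_depth assms by blast+
  next
    fix a b assume *: "depth lam (a, b) \<le> 0" "0 < depth \<mu> (a, b)"
    have "0 \<le> a" "a < int n" "0 \<le> b" using bnd[OF *] by auto
    then show "(a, b) \<in> region lam \<mu>"
      using * cell_below_above_depth assms by (auto simp: region_def)
  qed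
  show "(a, b) \<in> region lam \<mu> \<Longrightarrow> 0 \<le> a \<and> a + 1 < int n \<and> 1 \<le> b"
    using bnd eq by blast
qed

lemma depth_shift_down [simp]: "depth w (shift (1, -1) c) = depth w c + 1"
  by (cases c) (simp add: depth_def)

text \<open>A cell of the region whose translate by \<open>(1, -1)\<close> lies below the lower path is the bottom cell
  of its diagonal, that is, a cell of depth 0. This form of the definition depends on the
  paths only through \<open>ups\<close>.\<close>

lemma dyck_tiling_iff:
  "dyck_tiling n lam \<mu> D \<longleftrightarrow>
     dyck_path n lam \<and> dyck_path n \<mu> \<and> (\<forall>i. ups lam i \<le> ups \<mu> i) \<and>
     partition_on {c. depth lam c \<le> 0 \<and> 0 < depth \<mu> c} D \<and> (\<forall>\<eta>\<in>D. dyck_tile \<eta>) \<and>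
     (\<forall>\<eta>\<in>D. (\<forall>c\<in>\<eta>. depth lam c = 0) \<or> (\<exists>\<eta>'\<in>D. \<eta>' \<noteq> \<eta> \<and> shift (1, -1) ` \<eta> \<subseteq> \<eta>'))"
proof (cases "dyck_path n lam \<and> dyck_path n \<mu>")
  case True
  then have d: "dyck_path n lam" "dyck_path n \<mu>" by auto
  have below: "cell_below lam (shift (1, -1) c) \<longleftrightarrow> depth lam c = 0" if "c \<in> region lam \<mu>" for c
  proof -
    obtain a b where c: "c = (a, b)" by (cases c)
    have "0 \<le> a \<and> a + 1 < int n \<and> 1 \<le> b"
      using that region_depth(2)[OF d] c by blast
    then have "cell_below lam (shift (1, -1) c) \<longleftrightarrow> 0 < depth lam (shift (1, -1) c)"
      using cell_below_above_depth(1)[OF d(1), of "a + 1" "b - 1"] by (simp add: c add.commute)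
    moreover have "depth lam c \<le> 0" using that region_depth(1)[OF d] by blast
    ultimately show ?thesis unfolding depth_shift_down by linarith
  qed
  have cover: "(\<forall>c\<in>shift (1, -1) ` \<eta>. cell_below lam c) \<longleftrightarrow> (\<forall>c\<in>\<eta>. depth lam c = 0)"
    if "partition_on (region lam \<mu>) D" "\<eta> \<in> D" for \<eta>
  proof -
    have "\<eta> \<subseteq> region lam \<mu>" using that by (auto simp: partition_on_def)
    then show ?thesis using below by auto
  qed
  have len: "length lam = 2 * n" "length \<mu> = 2 * n" using d by (auto simp: dyck_path_iff)
  show ?thesis
    unfolding dyck_tiling_def using d cover weakly_above_iff[OF len]
    unfolding region_depth(1)[OF d] by (auto cong: conj_cong ball_cong)
qed (auto simp: dyck_tiling_def)

section \<open>Inserting a peak into a tiling\<close>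

text \<open>Deleting a peak of a path merges the diagonals of content \<open>p\<close>, \<open>p + 1\<close>, \<open>p + 2\<close> into one. The map
  sends each cell to its new position: content \<open>p + 1\<close> is lowered by \<open>(0, -1)\<close>, and everything to the
  right of it is moved by \<open>(-1, -1)\<close>. It commutes with the translation by \<open>(1, -1)\<close>. The
  inverse operation, inserting a peak, is the preimage under this map, for paths and for sets of
  cells alike.\<close>

fun contract :: "int \<Rightarrow> cell \<Rightarrow> cell" where
  "contract p (a, b) = (if a + b \<le> p then (a, b) else if a + b = p + 1 then (a, b - 1) else (a - 1, b - 1))"

lemma surj_contract: "surj (contract p)"
proof -
  have "\<exists>d. (a, b) = contract p d" for a b
  proof (cases "a + b \<le> p")
    case True
    then show ?thesis by (intro exI[of _ "(a, b)"]) simp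
  next
    case False
    then show ?thesis by (intro exI[of _ "(a + 1, b + 1)"]) simp
  qed
  then show ?thesis unfolding surj_def split_paired_All by blast
qed

lemma set_eq_pairI: "(\<And>a b. (a, b) \<in> A \<longleftrightarrow> (a, b) \<in> B) \<Longrightarrow> A = B"
  by auto

lemma contract_shift: "contract p (shift v c) = shift v (contract (p - fst v - snd v) c)"
  by (cases v; cases c) auto

lemma inj_shift: "inj (shift v)"
  by (cases v) (auto intro!: injI elim: shift.elims)

lemma shift_shift: "shift u (shift v c) = shift (fst u + fst v, snd u + snd v) c"
  by (cases u; cases v; cases c) auto

lemma vimage_contract_shift:
  "contract p -` (shift v ` L) = shift v ` (contract (p - fst v - snd v) -` L)"
proof -
  have "contract p c \<in> shift v ` L \<longleftrightarrow> c \<in> shift v ` (contract (p - fst v - snd v) -` L)" for c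
  proof -
    obtain d where c: "c = shift v d"
      by (cases v; cases c) (auto intro: that[of "(fst c - fst v, snd c - snd v)"])
    show ?thesis
      unfolding c contract_shift by (simp add: inj_image_mem_iff[OF inj_shift])
  qed
  then show ?thesis by (intro set_eqI) (simp only: vimage_eq)
qed

lemma lattice_points_insert_peak:
  "lattice_points (v @ Up # Down # w) = contract (int (length v)) -` lattice_points (v @ w)"
proof -
  have "(x, y) \<in> lattice_points (v @ Up # Down # w) \<longleftrightarrow>
      contract (int (length v)) (x, y) \<in> lattice_points (v @ w)" for x y
  proof -
    have e: "x + (y - 1) = x + y - 1" "x - 1 + (y - 1) = x + y - 2" by auto
    consider "x + y \<le> int (length v)" | "x + y = int (length v) + 1" | "int (length v) + 2 \<le> x + y"
      by linarith
    then show ?thesis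
      by cases (auto simp: mem_lattice_points ups_insert_peak e)
  qed
  then show ?thesis by (intro set_eq_pairI) (simp only: vimage_eq)
qed

lemma depth_insert_peak:
  "depth (v @ Up # Down # w) c = depth (v @ w) (contract (int (length v) - 1) c)"
proof (cases c)
  case (Pair a b)
  have e: "a + (b - 1) = a + b - 1" "a - 1 + (b - 1) = a + b - 2" by auto
  consider "a + b \<le> int (length v) - 1" | "a + b = int (length v)" | "int (length v) + 1 \<le> a + b"
    by linarith
  then show ?thesis
    by cases (auto simp: depth_def Pair ups_insert_peak e)
qed

lemma dyck_path_insert_peak:
  "dyck_path (Suc n) (v @ Up # Down # w) \<longleftrightarrow> dyck_path n (v @ w)"
proof
  assume *: "dyck_path (Suc n) (v @ Up # Down # w)"
  then have len: "length v + length w = 2 * n" by (simp add: dyck_path_iff)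
  have u: "ups (v @ w) i = (if i \<le> int (length v) then ups (v @ Up # Down # w) i
      else ups (v @ Up # Down # w) (i + 2) - 1)" for i
    unfolding ups_insert_peak by auto
  show "dyck_path n (v @ w)"
    unfolding dyck_path_iff
  proof (intro conjI allI impI)
    show "length (v @ w) = 2 * n" using len by simp
    have "ups (v @ Up # Down # w) (2 * int n + 2) = int n + 1"
      using * by (simp add: dyck_path_iff algebra_simps)
    then show "ups (v @ w) (2 * int n) = int n"
      using len unfolding ups_insert_peak by auto
    fix i assume i: "0 \<le> i \<and> i \<le> 2 * int n"
    have "j \<le> 2 * ups (v @ Up # Down # w) j" if "0 \<le> j" "j \<le> 2 * int n + 2" for j
      using * that unfolding dyck_path_iff by auto
    from this[of i] this[of "i + 2"] show "i \<le> 2 * ups (v @ w) i"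
      using i unfolding u by auto
  qed
next
  assume *: "dyck_path n (v @ w)"
  then have len: "length v + length w = 2 * n" and top: "ups (v @ w) (2 * int n) = int n"
    by (auto simp: dyck_path_iff)
  show "dyck_path (Suc n) (v @ Up # Down # w)"
    unfolding dyck_path_iff ups_insert_peak
  proof (intro conjI allI impI)
    show "length (v @ Up # Down # w) = 2 * Suc n" using len by simp
    show "(if 2 * int (Suc n) \<le> int (length v) then ups (v @ w) (2 * int (Suc n))
      else if 2 * int (Suc n) = int (length v) + 1 then ups (v @ w) (2 * int (Suc n) - 1) + 1
      else ups (v @ w) (2 * int (Suc n) - 2) + 1) = int (Suc n)"
      using len top by auto
    fix i assume i: "0 \<le> i \<and> i \<le> 2 * int (Suc n)"
    have "j \<le> 2 * ups (v @ w) j" if "0 \<le> j" "j \<le> 2 * int n" for j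
      using * that unfolding dyck_path_iff by auto
    from this[of i] this[of "i - 1"] this[of "i - 2"]
    show "i \<le> 2 * (if i \<le> int (length v) then ups (v @ w) i
      else if i = int (length v) + 1 then ups (v @ w) (i - 1) + 1
      else ups (v @ w) (i - 2) + 1)"
      using i len by auto
  qed
qed

lemma dyck_tile_shift: "dyck_tile \<eta> \<Longrightarrow> dyck_tile (shift v ` \<eta>)"
  unfolding dyck_tile_def by (force simp: image_image shift_shift)

text \<open>Only sets that meet the merged diagonal are stretched.\<close>

lemma vimage_contract_trivial:
  "(\<And>a b. (a, b) \<in> \<eta> \<Longrightarrow> a + b < p) \<Longrightarrow> contract p -` \<eta> = \<eta>"
  "(\<And>a b. (a, b) \<in> \<eta> \<Longrightarrow> p < a + b) \<Longrightarrow> contract p -` \<eta> = shift (1, 1) ` \<eta>"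
proof -
  assume *: "\<And>a b. (a, b) \<in> \<eta> \<Longrightarrow> a + b < p"
  have "contract p c \<in> \<eta> \<longleftrightarrow> c \<in> \<eta>" for c
    using *[of "fst c" "snd c"] *[of "fst c" "snd c - 1"] *[of "fst c - 1" "snd c - 1"]
    by (cases c) (force split: if_splits)
  then show "contract p -` \<eta> = \<eta>" by (intro set_eqI) (simp only: vimage_eq)
next
  assume *: "\<And>a b. (a, b) \<in> \<eta> \<Longrightarrow> p < a + b"
  have "contract p (a, b) \<in> \<eta> \<longleftrightarrow> (a - 1, b - 1) \<in> \<eta>" for a b
    using *[of a b] *[of a "b - 1"] *[of "a - 1" "b - 1"]
    by (force split: if_splits)
  moreover have "(a, b) \<in> shift (1, 1) ` \<eta> \<longleftrightarrow> (a - 1, b - 1) \<in> \<eta>" for a b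
    by (force simp: image_iff)
  ultimately show "contract p -` \<eta> = shift (1, 1) ` \<eta>"
    by (intro set_eq_pairI) (simp only: vimage_eq)
qed

text \<open>If the tile meets the diagonal of content \<open>p\<close>, its underlying Dyck path acquires a peak there;
  otherwise the tile is kept or translated.\<close>

lemma dyck_tile_vimage_contract:
  assumes "dyck_tile \<eta>"
  shows "dyck_tile (contract p -` \<eta>)"
proof -
  obtain m w v where w: "dyck_path m w" "\<eta> = shift v ` lattice_points w"
    using assms by (auto simp: dyck_tile_def)
  obtain x y where v: "v = (x, y)" by (cases v)
  define q where "q = p - x - y"
  have content: "x + y \<le> a + b \<and> a + b \<le> x + y + int (length w)" if "(a, b) \<in> \<eta>" for a b
    using that w(2) by (auto simp: v mem_lattice_points)
  consider "q < 0" | "int (length w) < q" | "0 \<le> q" "q \<le> int (length w)" by linarith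
  then show ?thesis
  proof cases
    case 1
    then have "contract p -` \<eta> = shift (1, 1) ` \<eta>"
      using content by (intro vimage_contract_trivial) (force simp: q_def)
    then show ?thesis using assms dyck_tile_shift by simp
  next
    case 2
    then have "contract p -` \<eta> = \<eta>"
      using content by (intro vimage_contract_trivial) (force simp: q_def)
    then show ?thesis using assms by simp
  next
    case 3
    let ?v = "take (nat q) w" and ?w = "drop (nat q) w"
    have "int (length ?v) = q" using 3 by auto
    then have "lattice_points (?v @ Up # Down # ?w) = contract q -` lattice_points w"
      unfolding lattice_points_insert_peak by simp
    then have "contract p -` \<eta> = shift v ` lattice_points (?v @ Up # Down # ?w)"
      unfolding w(2) vimage_contract_shift by (simp add: v q_def)
    moreover have "dyck_path (Suc m) (?v @ Up # Down # ?w)"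
      unfolding dyck_path_insert_peak using w(1) by simp
    ultimately show ?thesis unfolding dyck_tile_def by blast
  qed
qed

lemma surj_vimage_iff:
  assumes "surj f"
  shows "f -` X = f -` Y \<longleftrightarrow> X = Y" and "f -` X \<subseteq> f -` Y \<longleftrightarrow> X \<subseteq> Y"
    and "f -` X = {} \<longleftrightarrow> X = {}" and "(\<forall>c\<in>f -` X. P (f c)) \<longleftrightarrow> (\<forall>c\<in>X. P c)"
  using surj_image_vimage_eq[OF assms] by (metis, metis image_mono vimage_mono, metis vimage_empty, metis image_iff vimage_eq)

text \<open>Preimages under a surjection preserve and reflect unions, disjointness and nonemptiness.\<close>

lemma partition_on_vimage:
  assumes "surj f"
  shows "partition_on (f -` A) ((-`) f ` P) \<longleftrightarrow> partition_on A P"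
proof -
  have "\<Union> ((-`) f ` P) = f -` \<Union>P" by auto
  then have "\<Union> ((-`) f ` P) = f -` A \<longleftrightarrow> \<Union>P = A"
    by (simp only: surj_vimage_iff[OF assms])
  moreover have "{} \<in> (-`) f ` P \<longleftrightarrow> {} \<in> P"
    using surj_vimage_iff(3)[OF assms] by (metis image_iff vimage_empty)
  moreover have "disjoint ((-`) f ` P) \<longleftrightarrow> disjoint P"
    by (simp add: pairwise_def disjnt_def surj_vimage_iff[OF assms] flip: vimage_Int)
  ultimately show ?thesis by (simp add: partition_on_def)
qed

lemma weakly_above_insert_peak:
  assumes "length v' = length v"
  shows "(\<forall>i. ups (v' @ Up # Down # w') i \<le> ups (v @ Up # Down # w) i) \<longleftrightarrow>
         (\<forall>i. ups (v' @ w') i \<le> ups (v @ w) i)"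
proof
  assume *: "\<forall>i. ups (v' @ Up # Down # w') i \<le> ups (v @ Up # Down # w) i"
  show "\<forall>i. ups (v' @ w') i \<le> ups (v @ w) i"
  proof
    fix i
    show "ups (v' @ w') i \<le> ups (v @ w) i"
      using *[rule_format, of i] *[rule_format, of "i + 2"] assms
      unfolding ups_insert_peak by (auto split: if_splits)
  qed
qed (use assms in \<open>auto simp: ups_insert_peak\<close>)

text \<open>Inserting a peak at the same position into both paths and all tiles means taking preimages
  under a surjection that preserves depths and commutes with the translation by \<open>(1, -1)\<close>. So
  the partition and the covering condition are transported in both directions.\<close>

lemma dyck_tiling_insert_peak:
  assumes len: "length v' = length v" and tiles: "\<forall>\<eta>\<in>D. dyck_tile \<eta>"
    and p: "p = int (length v) - 1"
  shows "dyck_tiling (Suc n) (v' @ Up # Down # w') (v @ Up # Down # w) ((-`) (contract p) ` D) \<longleftrightarrow>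
         dyck_tiling n (v' @ w') (v @ w) D"
proof -
  let ?f = "contract p"
  note surj_f = surj_vimage_iff[OF surj_contract[of p]]
  have depth: "depth (v @ Up # Down # w) c = depth (v @ w) (?f c)"
    "depth (v' @ Up # Down # w') c = depth (v' @ w') (?f c)" for c
    unfolding depth_insert_peak using len p by (simp_all only:)
  have shift: "shift (1, -1) ` (?f -` X) = ?f -` (shift (1, -1) ` X)" for X
    unfolding vimage_contract_shift by simp
  have "{c. depth (v' @ Up # Down # w') c \<le> 0 \<and> 0 < depth (v @ Up # Down # w) c} =
      ?f -` {c. depth (v' @ w') c \<le> 0 \<and> 0 < depth (v @ w) c}"
    by (simp only: depth vimage_def mem_Collect_eq)
  then have part: "partition_on {c. depth (v' @ Up # Down # w') c \<le> 0 \<and> 0 < depth (v @ Up # Down # w) c} ((-`) ?f ` D) \<longleftrightarrow>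
      partition_on {c. depth (v' @ w') c \<le> 0 \<and> 0 < depth (v @ w) c} D"
    by (simp only: partition_on_vimage[OF surj_contract])
  have bottom: "(\<forall>c\<in>?f -` X. depth (v' @ Up # Down # w') c = 0) \<longleftrightarrow> (\<forall>c\<in>X. depth (v' @ w') c = 0)" for X
    unfolding depth by (rule surj_f(4))
  have cover: "(\<forall>\<eta>\<in>(-`) ?f ` D. (\<forall>c\<in>\<eta>. depth (v' @ Up # Down # w') c = 0) \<or>
        (\<exists>\<eta>'\<in>(-`) ?f ` D. \<eta>' \<noteq> \<eta> \<and> shift (1, -1) ` \<eta> \<subseteq> \<eta>')) \<longleftrightarrow>
      (\<forall>\<eta>\<in>D. (\<forall>c\<in>\<eta>. depth (v' @ w') c = 0) \<or> (\<exists>\<eta>'\<in>D. \<eta>' \<noteq> \<eta> \<and> shift (1, -1) ` \<eta> \<subseteq> \<eta>'))"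
    by (simp only: ball_simps bex_simps bottom shift surj_f(1,2))
  have "\<forall>\<eta>\<in>(-`) ?f ` D. dyck_tile \<eta>"
    using tiles dyck_tile_vimage_contract by blast
  then show ?thesis
    unfolding dyck_tiling_iff dyck_path_insert_peak weakly_above_insert_peak[OF len] part cover
    using tiles by blast
qed

section \<open>The cell below a peak of the upper path\<close>

text \<open>In a path \<open>v @ Up # Down # w\<close> this is the cell whose upper left corner is the peak
  after \<open>v @ [Up]\<close>.\<close>

definition peak_cell :: "step list \<Rightarrow> cell" where
  "peak_cell v = (int (count_list v Down), int (count_list v Up))"

lemma content_peak_cell: "fst (peak_cell v) + snd (peak_cell v) = int (length v)"
  using count_Up_plus_Down[of v] by (simp add: peak_cell_def)

lemma depth_same_content:
  "fst c + snd c = fst d + snd d \<Longrightarrow> depth w c = depth w d + snd d - snd c"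
  by (simp add: depth_def)

lemma depth_peak_cell: "depth (v @ Up # Down # w) (peak_cell v) = 1"
proof -
  have "ups (v @ Up # Down # w) (int (length v) + 1) = snd (peak_cell v) + 1"
    by (simp add: ups_insert_peak) (simp add: ups_append ups_def peak_cell_def)
  then show ?thesis by (simp add: depth_def content_peak_cell)
qed

lemma depth_flip_peak:
  "depth (v @ Down # Up # w) c =
     depth (v @ Up # Down # w) c - (if fst c + snd c = int (length v) then 1 else 0)"
  by (simp add: depth_def ups_flip_peak)

lemma depth_flip_peak_pos:
  "0 < depth (v @ Down # Up # w) c \<longleftrightarrow> 0 < depth (v @ Up # Down # w) c \<and> c \<noteq> peak_cell v"
proof (cases "fst c + snd c = int (length v)")
  case True
  then have "depth (v @ Up # Down # w) c = 1 + snd (peak_cell v) - snd c"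
    using depth_same_content[of c "peak_cell v"] depth_peak_cell content_peak_cell by simp
  moreover have "c = peak_cell v \<longleftrightarrow> snd c = snd (peak_cell v)"
    using True content_peak_cell[of v] by (auto simp: prod_eq_iff)
  ultimately show ?thesis using True by (auto simp: depth_flip_peak)
qed (auto simp: depth_flip_peak content_peak_cell)

lemma dyck_tile_singleton: "dyck_tile {c}"
proof -
  have "{c} = shift c ` lattice_points []"
    by (cases c) (simp add: lattice_points_def pt_def)
  moreover have "dyck_path 0 []" by (simp add: dyck_path_def pt_def)
  ultimately show ?thesis unfolding dyck_tile_def by blast
qed

text \<open>When the peak cell is a tile by itself, it can be cut off, which turns the peak into a valley.
  No other tile relied on it for the covering condition, because a tile resting on the peak cell
  would contain a cell above the upper path.\<close>

lemma remove_peak_tile: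
  assumes T: "dyck_tiling n lam (v @ Up # Down # w) D" and peak: "{peak_cell v} \<in> D"
  shows "dyck_tiling n lam (v @ Down # Up # w) (D - {{peak_cell v}})"
proof -
  let ?\<mu> = "v @ Up # Down # w" and ?\<mu>' = "v @ Down # Up # w" and ?c = "peak_cell v"
  have lam: "dyck_path n lam" and \<mu>: "dyck_path n ?\<mu>" and above: "\<And>i. ups lam i \<le> ups ?\<mu> i"
    and part: "partition_on {c. depth lam c \<le> 0 \<and> 0 < depth ?\<mu> c} D"
    and tile: "\<And>\<eta>. \<eta> \<in> D \<Longrightarrow> dyck_tile \<eta>"
    and cover: "\<And>\<eta>. \<eta> \<in> D \<Longrightarrow> (\<forall>c\<in>\<eta>. depth lam c = 0) \<or> (\<exists>\<eta>'\<in>D. \<eta>' \<noteq> \<eta> \<and> shift (1, -1) ` \<eta> \<subseteq> \<eta>')"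
    using T unfolding dyck_tiling_iff by auto
  have "depth lam ?c \<le> 0" using part peak by (auto simp: partition_on_def)
  then have "ups lam (int (length v) + 1) < ups ?\<mu> (int (length v) + 1)"
    using depth_peak_cell[of v w] by (simp add: depth_def content_peak_cell)
  then have above': "ups lam i \<le> ups ?\<mu>' i" for i
    using above[of i] by (auto simp: ups_flip_peak)
  have \<mu>': "dyck_path n ?\<mu>'"
    unfolding dyck_path_iff
  proof (intro conjI allI impI)
    show "length ?\<mu>' = 2 * n" using \<mu> by (simp add: dyck_path_iff)
    have "length v + 2 \<le> 2 * n" using \<mu> by (simp add: dyck_path_iff)
    then show "ups ?\<mu>' (2 * int n) = int n" using \<mu> by (simp add: ups_flip_peak dyck_path_iff)
    fix i assume "0 \<le> i \<and> i \<le> 2 * int n"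
    then have "i \<le> 2 * ups lam i" using lam by (simp add: dyck_path_iff)
    then show "i \<le> 2 * ups ?\<mu>' i" using above'[of i] by simp
  qed
  have set: "{c. depth lam c \<le> 0 \<and> 0 < depth ?\<mu>' c} = {c. depth lam c \<le> 0 \<and> 0 < depth ?\<mu> c} - {?c}"
    by (auto simp: depth_flip_peak_pos)
  have part': "partition_on ({c. depth lam c \<le> 0 \<and> 0 < depth ?\<mu> c} - {?c}) (D - {{?c}})"
  proof -
    have "disjoint D" "{} \<notin> D" and Un: "\<Union>D = {c. depth lam c \<le> 0 \<and> 0 < depth ?\<mu> c}"
      using part by (simp_all add: partition_on_def)
    have "\<Union>(D - {{?c}}) = \<Union>D - {?c}"
      using diff_Union_pairwise_disjoint[OF \<open>disjoint D\<close>, of "{{?c}}"] peak by simp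
    moreover have "disjoint (D - {{?c}})" using \<open>disjoint D\<close> by (rule pairwise_subset) auto
    ultimately show ?thesis using \<open>{} \<notin> D\<close> unfolding partition_on_def Un by simp
  qed
  have cover': "(\<forall>c\<in>\<eta>. depth lam c = 0) \<or> (\<exists>\<eta>'\<in>D - {{?c}}. \<eta>' \<noteq> \<eta> \<and> shift (1, -1) ` \<eta> \<subseteq> \<eta>')"
    if \<eta>: "\<eta> \<in> D - {{?c}}" for \<eta>
  proof (rule disjCI)
    assume "\<not> (\<exists>\<eta>'\<in>D - {{?c}}. \<eta>' \<noteq> \<eta> \<and> shift (1, -1) ` \<eta> \<subseteq> \<eta>')"
    moreover have "\<not> shift (1, -1) ` \<eta> \<subseteq> {?c}"
    proof
      assume *: "shift (1, -1) ` \<eta> \<subseteq> {?c}"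
      have "\<eta> \<noteq> {}" using \<eta> partition_onD3[OF part] by (metis DiffD1)
      then obtain d where d: "d \<in> \<eta>" by blast
      then have "0 < depth ?\<mu> d" using \<eta> part by (auto simp: partition_on_def)
      moreover have "shift (1, -1) d = ?c" using * d by auto
      ultimately show False using depth_shift_down[of ?\<mu> d] depth_peak_cell[of v w] by simp
    qed
    ultimately show "\<forall>c\<in>\<eta>. depth lam c = 0" using cover[of \<eta>] \<eta> by auto
  qed
  have tile': "dyck_tile \<eta>" if "\<eta> \<in> D - {{?c}}" for \<eta> using tile that by blast
  show ?thesis
    unfolding dyck_tiling_iff set by (intro conjI allI ballI lam \<mu>' above' part' tile' cover')
qed

text \<open>A single cell on top never violates the covering condition: its translate is one cell, hence
  it is below the lower path or lies in some tile.\<close>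

lemma add_peak_tile:
  assumes T: "dyck_tiling n lam (v @ Down # Up # w) D"
  shows "dyck_tiling n lam (v @ Up # Down # w) (insert {peak_cell v} D)" and "peak_cell v \<notin> \<Union>D"
proof -
  let ?\<mu> = "v @ Up # Down # w" and ?\<mu>' = "v @ Down # Up # w" and ?c = "peak_cell v"
  have lam: "dyck_path n lam" and \<mu>': "dyck_path n ?\<mu>'" and above': "\<And>i. ups lam i \<le> ups ?\<mu>' i"
    and part: "partition_on {c. depth lam c \<le> 0 \<and> 0 < depth ?\<mu>' c} D"
    and tile: "\<And>\<eta>. \<eta> \<in> D \<Longrightarrow> dyck_tile \<eta>"
    and cover: "\<And>\<eta>. \<eta> \<in> D \<Longrightarrow> (\<forall>c\<in>\<eta>. depth lam c = 0) \<or> (\<exists>\<eta>'\<in>D. \<eta>' \<noteq> \<eta> \<and> shift (1, -1) ` \<eta> \<subseteq> \<eta>')"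
    using T unfolding dyck_tiling_iff by auto
  have Un: "\<Union>D = {c. depth lam c \<le> 0 \<and> 0 < depth ?\<mu>' c}" using part by (auto simp: partition_on_def)
  then show notin: "?c \<notin> \<Union>D" by (simp add: depth_flip_peak_pos)
  have le: "ups ?\<mu>' i \<le> ups ?\<mu> i" for i by (simp add: ups_flip_peak)
  have above: "ups lam i \<le> ups ?\<mu> i" for i using above'[of i] le[of i] by simp
  have \<mu>: "dyck_path n ?\<mu>"
    unfolding dyck_path_iff
  proof (intro conjI allI impI)
    show "length ?\<mu> = 2 * n" using \<mu>' by (simp add: dyck_path_iff)
    have "length v + 2 \<le> 2 * n" using \<mu>' by (simp add: dyck_path_iff)
    then show "ups ?\<mu> (2 * int n) = int n" using \<mu>' by (simp add: ups_flip_peak dyck_path_iff)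
    fix i assume "0 \<le> i \<and> i \<le> 2 * int n"
    then have "i \<le> 2 * ups ?\<mu>' i" using \<mu>' by (simp add: dyck_path_iff)
    then show "i \<le> 2 * ups ?\<mu> i" using le[of i] by simp
  qed
  have bot: "depth lam ?c \<le> 0"
    using above'[of "int (length v) + 1"] depth_peak_cell[of v w]
    by (simp add: depth_def content_peak_cell ups_flip_peak)
  have set: "{c. depth lam c \<le> 0 \<and> 0 < depth ?\<mu> c} = insert ?c {c. depth lam c \<le> 0 \<and> 0 < depth ?\<mu>' c}"
    using bot depth_peak_cell[of v w] by (auto simp: depth_flip_peak_pos)
  have part': "partition_on (insert ?c {c. depth lam c \<le> 0 \<and> 0 < depth ?\<mu>' c}) (insert {?c} D)"
    using part notin unfolding Un[symmetric] by (auto simp: partition_on_def disjoint_def)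
  have new: "(\<forall>c\<in>{?c}. depth lam c = 0) \<or> (\<exists>\<eta>'\<in>insert {?c} D. \<eta>' \<noteq> {?c} \<and> shift (1, -1) ` {?c} \<subseteq> \<eta>')"
  proof (rule disjCI)
    let ?d = "shift (1, -1) ?c"
    assume no: "\<not> (\<exists>\<eta>'\<in>insert {?c} D. \<eta>' \<noteq> {?c} \<and> shift (1, -1) ` {?c} \<subseteq> \<eta>')"
    show "\<forall>c\<in>{?c}. depth lam c = 0"
    proof (rule ccontr)
      assume "\<not> (\<forall>c\<in>{?c}. depth lam c = 0)"
      then have "depth lam ?d \<le> 0" using bot by simp
      moreover have "0 < depth ?\<mu>' ?d"
        using depth_peak_cell[of v w] by (simp add: depth_flip_peak content_peak_cell)
      ultimately obtain \<eta>' where "\<eta>' \<in> D" "?d \<in> \<eta>'" using Un by blast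
      then show False using no notin by auto
    qed
  qed
  have cover': "(\<forall>c\<in>\<eta>. depth lam c = 0) \<or> (\<exists>\<eta>'\<in>insert {?c} D. \<eta>' \<noteq> \<eta> \<and> shift (1, -1) ` \<eta> \<subseteq> \<eta>')"
    if "\<eta> \<in> insert {?c} D" for \<eta>
    using that
  proof
    assume "\<eta> = {?c}"
    then show ?thesis using new by simp
  next
    assume "\<eta> \<in> D"
    then show ?thesis using cover[of \<eta>] by blast
  qed
  have tile': "dyck_tile \<eta>" if "\<eta> \<in> insert {?c} D" for \<eta>
    using that tile dyck_tile_singleton by blast
  show "dyck_tiling n lam ?\<mu> (insert {?c} D)"
    unfolding dyck_tiling_iff set by (intro conjI allI ballI lam \<mu> above part' tile' cover')
qed

lemma mem_dyck_tile:
  "(a, b) \<in> shift (x, y) ` lattice_points u \<longleftrightarrow>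
     0 \<le> a + b - x - y \<and> a + b - x - y \<le> int (length u) \<and> b = y + ups u (a + b - x - y)"
proof -
  have "(a, b) \<in> shift (x, y) ` lattice_points u \<longleftrightarrow> (a - x, b - y) \<in> lattice_points u"
    by (force simp: image_iff)
  moreover have "a - x + (b - y) = a + b - x - y" by simp
  ultimately show ?thesis unfolding mem_lattice_points by (auto simp: algebra_simps)
qed

text \<open>A Dyck path of positive length starts with an up step and ends with a down step, so a cell
  with no higher neighbour in its tile is not an end of the tile and has both lower neighbours.\<close>

lemma dyck_tile_local_peak:
  assumes tile: "dyck_tile \<eta>" and mem: "(a, b) \<in> \<eta>" and top: "(a, b + 1) \<notin> \<eta>" "(a - 1, b) \<notin> \<eta>"
    and big: "\<eta> \<noteq> {(a, b)}"
  shows "(a, b - 1) \<in> \<eta> \<and> (a + 1, b) \<in> \<eta>"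
proof -
  obtain m u x y where u: "dyck_path m u" "\<eta> = shift (x, y) ` lattice_points u"
    using tile by (auto simp: dyck_tile_def)
  have len: "int (length u) = 2 * int m" and topm: "ups u (2 * int m) = int m"
    and dyck: "\<And>j. 0 \<le> j \<Longrightarrow> j \<le> 2 * int m \<Longrightarrow> j \<le> 2 * ups u j"
    using u(1) by (auto simp: dyck_path_iff)
  define i where "i = a + b - x - y"
  have i: "0 \<le> i" "i \<le> 2 * int m" "b = y + ups u i"
    using mem unfolding u(2) mem_dyck_tile len i_def by auto
  have right: "(a + 1, b) \<in> \<eta>" "ups u (i + 1) = ups u i" if "i < 2 * int m"
  proof -
    have e: "a + (b + 1) - x - y = i + 1" "a + 1 + b - x - y = i + 1" by (auto simp: i_def)
    have "ups u (i + 1) \<noteq> ups u i + 1"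
      using top(1) that i unfolding u(2) mem_dyck_tile len e by auto
    then show "ups u (i + 1) = ups u i" using ups_bounds[of u i] by linarith
    then show "(a + 1, b) \<in> \<eta>" using that i unfolding u(2) mem_dyck_tile len e by auto
  qed
  have left: "(a, b - 1) \<in> \<eta>" "ups u (i - 1) = ups u i - 1" if "0 < i"
  proof -
    have e: "a + (b - 1) - x - y = i - 1" "a - 1 + b - x - y = i - 1" by (auto simp: i_def)
    have "ups u (i - 1) \<noteq> ups u i"
      using top(2) that i unfolding u(2) mem_dyck_tile len e by auto
    then show "ups u (i - 1) = ups u i - 1" using ups_bounds[of u "i - 1"] by auto
    then show "(a, b - 1) \<in> \<eta>" using that i unfolding u(2) mem_dyck_tile len e by auto
  qed
  have "m \<noteq> 0"
  proof
    assume "m = 0"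
    then have "(a', b') \<in> \<eta> \<longleftrightarrow> (a', b') = (a, b)" for a' b'
      using i unfolding u(2) mem_dyck_tile len i_def by auto
    then show False using big by auto
  qed
  have "i \<noteq> 0" using right(2) dyck[of 1] \<open>m \<noteq> 0\<close> by auto
  moreover have "i \<noteq> 2 * int m" using left(2) dyck[of "i - 1"] \<open>m \<noteq> 0\<close> topm by auto
  ultimately show ?thesis using left(1) right(1) i by auto
qed

text \<open>This is where the covering condition acts. If the peak cell is not a tile by itself, then its
  tile contains both its lower neighbours, because the higher ones are outside the region. Going down
  the diagonal, each tile contains the translate of the previous one, and so inherits
  this property.\<close>

lemma tile_through_peak_column:
  assumes T: "dyck_tiling n lam (v @ Up # Down # w) D" and peak: "{peak_cell v} \<notin> D"
    and "\<eta> \<in> D" "(a, b) \<in> \<eta>" "a + b = int (length v)"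
  shows "(a, b - 1) \<in> \<eta> \<and> (a + 1, b) \<in> \<eta>"
  using assms(3-5)
\<comment> \<open>Induction on the distance to the peak cell along the diagonal.\<close>
proof (induction "nat (snd (peak_cell v) - b)" arbitrary: a b \<eta>)
  case 0
  let ?\<mu> = "v @ Up # Down # w" and ?c = "peak_cell v"
  have part: "partition_on {c. depth lam c \<le> 0 \<and> 0 < depth ?\<mu> c} D"
    using T unfolding dyck_tiling_iff by auto
  then have sub: "\<And>c. c \<in> \<eta> \<Longrightarrow> 0 < depth ?\<mu> c" using 0 by (auto simp: partition_on_def)
  have "depth ?\<mu> (a, b) = 1 + snd ?c - b"
    using depth_same_content[of "(a, b)" ?c ?\<mu>] 0 by (simp add: depth_peak_cell content_peak_cell)
  then have b: "b = snd ?c" using sub[OF 0(3)] 0(1) by auto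
  then have c: "?c = (a, b)" using content_peak_cell[of v] 0 by (auto simp: prod_eq_iff)
  have "ups ?\<mu> (a + b + 1) = b + 1" using depth_peak_cell[of v w] by (simp add: c depth_def)
  moreover have "ups ?\<mu> (a + b) = b"
    using calculation ups_bounds[of ?\<mu> "a + b"] 0(4) by (simp add: ups_insert_peak)
  moreover have "ups ?\<mu> (a + b + 2) = b + 1"
    using calculation 0(4) by (simp add: ups_insert_peak)
  ultimately have "depth ?\<mu> (a, b + 1) = 0" "depth ?\<mu> (a - 1, b) = 0"
    by (auto simp: depth_def algebra_simps)
  then have "(a, b + 1) \<notin> \<eta>" "(a - 1, b) \<notin> \<eta>" using sub by fastforce+
  moreover have "\<eta> \<noteq> {(a, b)}" using peak 0 by (auto simp: c)
  moreover have "dyck_tile \<eta>" using T 0 unfolding dyck_tiling_iff by auto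
  ultimately show ?case using dyck_tile_local_peak 0(3) by blast
next
  case (Suc k)
  let ?\<mu> = "v @ Up # Down # w"
  have part: "partition_on {c. depth lam c \<le> 0 \<and> 0 < depth ?\<mu> c} D"
    and cover: "\<And>\<eta>. \<eta> \<in> D \<Longrightarrow> (\<forall>c\<in>\<eta>. depth lam c = 0) \<or> (\<exists>\<eta>'\<in>D. \<eta>' \<noteq> \<eta> \<and> shift (1, -1) ` \<eta> \<subseteq> \<eta>')"
    using T unfolding dyck_tiling_iff by auto
  let ?z = "(a - 1, b + 1)"
  have sh: "shift (1, -1) ?z = (a, b)" by simp
  have "depth lam (a, b) \<le> 0" using Suc part by (auto simp: partition_on_def)
  then have z: "depth lam ?z < 0" using depth_shift_down[of lam ?z] unfolding sh by simp
  have "depth ?\<mu> ?z = 1 + snd (peak_cell v) - (b + 1)"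
    using depth_same_content[of ?z "peak_cell v" ?\<mu>] Suc.prems
    by (simp add: depth_peak_cell content_peak_cell)
  then have "0 < depth ?\<mu> ?z" using Suc(2) by auto
  then have "?z \<in> \<Union>D" using z part by (auto simp: partition_on_def)
  then obtain \<theta> where \<theta>: "\<theta> \<in> D" "?z \<in> \<theta>" by blast
  have "(a - 1, b + 1 - 1) \<in> \<theta> \<and> (a - 1 + 1, b + 1) \<in> \<theta>"
    using Suc.hyps(1)[of "b + 1" \<theta> "a - 1"] \<theta> Suc(2) Suc.prems by auto
  then have nb: "(a - 1, b) \<in> \<theta>" "(a, b + 1) \<in> \<theta>" by auto
  obtain \<eta>' where \<eta>': "\<eta>' \<in> D" "shift (1, -1) ` \<theta> \<subseteq> \<eta>'"
    using cover[OF \<theta>(1)] z \<theta>(2) by fastforce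
  have in': "(a, b) \<in> \<eta>'" "(a, b - 1) \<in> \<eta>'" "(a + 1, b) \<in> \<eta>'"
    using \<eta>'(2) \<theta>(2) nb by force+
  moreover have "\<eta>' = \<eta>"
    using part Suc.prems \<eta>'(1) in'(1) by (auto simp: partition_on_def disjoint_def)
  ultimately show ?case by simp
qed

text \<open>The closure conditions say that \<open>\<eta>\<close> either passes over the three merged diagonals in the form
  of a peak or avoids all of them; in both cases it arises by inserting a peak into a Dyck tile.\<close>

lemma dyck_tile_eq_vimage_contract:
  assumes tile: "dyck_tile \<eta>"
    and mid: "\<And>a b. (a, b) \<in> \<eta> \<Longrightarrow> a + b = p + 1 \<Longrightarrow> (a, b - 1) \<in> \<eta> \<and> (a + 1, b) \<in> \<eta>"
    and left: "\<And>a b. (a, b) \<in> \<eta> \<Longrightarrow> a + b = p \<Longrightarrow> (a, b + 1) \<in> \<eta>"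
    and right: "\<And>a b. (a, b) \<in> \<eta> \<Longrightarrow> a + b = p + 2 \<Longrightarrow> (a - 1, b) \<in> \<eta>"
  shows "\<exists>\<theta>. dyck_tile \<theta> \<and> \<eta> = contract p -` \<theta>"
proof -
  obtain m u x y where u: "dyck_path m u" "\<eta> = shift (x, y) ` lattice_points u"
    using tile by (auto simp: dyck_tile_def)
  have occurs: "(k - (y + ups u (k - x - y)), y + ups u (k - x - y)) \<in> \<eta>"
    if "x + y \<le> k" "k \<le> x + y + int (length u)" for k
    using that unfolding u(2) mem_dyck_tile by simp
  show ?thesis
  proof (cases "\<exists>a b. (a, b) \<in> \<eta> \<and> a + b = p + 1")
    case True
    then obtain a b where ab: "(a, b) \<in> \<eta>" "a + b = p + 1" by blast
    define j where "j = nat (p - x - y)"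
    have nb: "(a, b - 1) \<in> \<eta>" "(a + 1, b) \<in> \<eta>" using mid[OF ab] by auto
    have e: "a + b - x - y = p - x - y + 1" "a + (b - 1) - x - y = p - x - y"
      "a + 1 + b - x - y = p - x - y + 2"
      using ab(2) by auto
    have "0 \<le> p - x - y" using nb(1) unfolding u(2) mem_dyck_tile e by simp
    then have j: "p - x - y = int j" by (simp add: j_def)
    have jl: "Suc j < length u" using nb(2) unfolding u(2) mem_dyck_tile e j by simp
    have up: "ups u (int j + 1) = ups u (int j) + 1" "ups u (int j + 1 + 1) = ups u (int j + 1)"
      using ab(1) nb unfolding u(2) mem_dyck_tile e j by (simp_all add: add.commute)
    have "u ! j = Up" using up(1) ups_step[of "int j" u] jl by (auto split: if_splits)
    moreover have "nat (int j + 1) = Suc j" by simp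
    then have "u ! Suc j \<noteq> Up" using up(2) ups_step[of "int j + 1" u] jl by (auto split: if_splits)
    then have "u ! Suc j = Down" by (cases "u ! Suc j") auto
    ultimately have "u = take j u @ Up # Down # drop (j + 2) u"
      using jl id_take_nth_drop[of j u] Cons_nth_drop_Suc[of "Suc j" u] by simp
    moreover have "length (take j u) = j" using jl by simp
    ultimately obtain v w where split: "u = v @ Up # Down # w" and v: "length v = j" by blast
    have "\<eta> = contract p -` (shift (x, y) ` lattice_points (v @ w))"
      unfolding u(2) vimage_contract_shift split lattice_points_insert_peak by (simp add: j v)
    moreover have "dyck_path (m - 1) (v @ w)"
    proof -
      have "m \<noteq> 0" using jl u(1) by (auto simp: dyck_path_iff)
      then have "dyck_path (Suc (m - 1)) (v @ Up # Down # w)"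
        using u(1) by (simp add: split)
      then show ?thesis by (simp only: dyck_path_insert_peak)
    qed
    ultimately show ?thesis unfolding dyck_tile_def by blast
  next
    case False
    have none: "a + b \<noteq> p \<and> a + b \<noteq> p + 1 \<and> a + b \<noteq> p + 2" if "(a, b) \<in> \<eta>" for a b
      using that left[of a b] right[of a b] False by fastforce
    have content: "x + y \<le> a + b \<and> a + b \<le> x + y + int (length u)" if "(a, b) \<in> \<eta>" for a b
      using that unfolding u(2) mem_dyck_tile by auto
    \<comment> \<open>The contents of a tile form an interval, so avoiding three consecutive values puts the
      whole tile on one side of them.\<close>
    have "\<not> (x + y \<le> p \<and> p \<le> x + y + int (length u))"
      using occurs[of p] none by fastforce
    then consider "p < x + y" | "x + y + int (length u) < p" by linarith
    then show ?thesis
    proof cases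
      case 1
      then have "p + 2 < a + b" if "(a, b) \<in> \<eta>" for a b
        using none[OF that] content[OF that] by linarith
      then have "contract p -` (shift (-1, -1) ` \<eta>) = shift (1, 1) ` shift (-1, -1) ` \<eta>"
        by (intro vimage_contract_trivial(2)) fastforce
      also have "\<dots> = \<eta>" by (simp add: image_image shift_shift) (force simp: image_iff)
      finally show ?thesis using dyck_tile_shift[OF tile] by blast
    next
      case 2
      then have "contract p -` \<eta> = \<eta>"
        using content by (intro vimage_contract_trivial(1)) fastforce
      then show ?thesis using tile by blast
    qed
  qed
qed

text \<open>The converse of inserting a peak: if the peak cell is not a tile by itself, then every tile
  that meets its diagonal peaks there. The bottom tile forces the lower path to have a peak at the
  same position, so the three diagonals carry equally many cells, and the whole picture can
  be contracted.\<close>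

lemma contract_peak:
  assumes T: "dyck_tiling (Suc n) lam (v @ Up # Down # w) D" and peak: "{peak_cell v} \<notin> D"
  obtains v' w' D' where "length v' = length v" "lam = v' @ Up # Down # w'"
    "D = (-`) (contract (int (length v) - 1)) ` D'" "dyck_tiling n (v' @ w') (v @ w) D'"
proof -
  let ?\<mu> = "v @ Up # Down # w" and ?s = "int (length v)"
  have lam: "dyck_path (Suc n) lam" and \<mu>: "dyck_path (Suc n) ?\<mu>" and above: "\<And>i. ups lam i \<le> ups ?\<mu> i"
    and part: "partition_on {c. depth lam c \<le> 0 \<and> 0 < depth ?\<mu> c} D"
    and tile: "\<And>\<eta>. \<eta> \<in> D \<Longrightarrow> dyck_tile \<eta>"
    using T unfolding dyck_tiling_iff by auto
  have Un: "\<Union>D = {c. depth lam c \<le> 0 \<and> 0 < depth ?\<mu> c}" using part by (auto simp: partition_on_def)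
  note through = tile_through_peak_column[OF T peak]
  have ups_mu: "ups ?\<mu> (?s + 1) = ups ?\<mu> ?s + 1" "ups ?\<mu> (?s + 2) = ups ?\<mu> (?s + 1)"
    by (simp_all add: ups_insert_peak)
  have len: "length v + 2 \<le> length lam" using lam \<mu> by (simp add: dyck_path_iff)
  \<comment> \<open>If the diagonal carries no cell, the lower path touches the upper one at its peak. Otherwise
    both lower neighbours of the bottom cell lie above the lower path.\<close>
  have steps: "ups lam (?s + 1) = ups lam ?s + 1 \<and> ups lam (?s + 1 + 1) = ups lam (?s + 1)"
  proof (cases "ups lam (?s + 1) = ups ?\<mu> (?s + 1)")
    case True
    then show ?thesis
      using above[of ?s] above[of "?s + 2"] ups_mu ups_bounds[of lam ?s] ups_bounds[of lam "?s + 1"]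
      by (simp add: add.commute)
  next
    case False
    define b where "b = ups lam (?s + 1)"
    define a where "a = ?s - b"
    have "(a, b) \<in> \<Union>D"
      unfolding Un using above[of "?s + 1"] False by (simp add: depth_def a_def b_def)
    then obtain \<eta> where \<eta>: "\<eta> \<in> D" "(a, b) \<in> \<eta>" by blast
    then have "(a, b - 1) \<in> \<Union>D" "(a + 1, b) \<in> \<Union>D"
      using through[OF \<eta>] by (auto simp: a_def)
    then have "ups lam ?s \<le> b - 1" "ups lam (?s + 1 + 1) \<le> b"
      unfolding Un by (auto simp: depth_def a_def add.commute)
    then show ?thesis
      using ups_bounds[of lam ?s] ups_bounds[of lam "?s + 1"] unfolding b_def by linarith
  qed
  have "lam ! length v = Up" using steps ups_step[of ?s lam] len by (auto split: if_splits)
  moreover have "nat (?s + 1) = Suc (length v)" by simp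
  then have "lam ! Suc (length v) \<noteq> Up" using steps ups_step[of "?s + 1" lam] len by (auto split: if_splits)
  then have "lam ! Suc (length v) = Down" by (cases "lam ! Suc (length v)") auto
  ultimately have "lam = take (length v) lam @ Up # Down # drop (length v + 2) lam"
    using len id_take_nth_drop[of "length v" lam] Cons_nth_drop_Suc[of "Suc (length v)" lam] by simp
  moreover have "length (take (length v) lam) = length v" using len by simp
  ultimately obtain v' w' where split: "lam = v' @ Up # Down # w'" and v': "length v' = length v" by blast
  have same: "\<eta> = \<theta>" if "\<eta> \<in> D" "\<theta> \<in> D" "c \<in> \<eta>" "c \<in> \<theta>" for \<eta> \<theta> c
    using part that by (auto simp: partition_on_def disjoint_def)
  have ex: "\<exists>\<theta>. dyck_tile \<theta> \<and> \<eta> = contract (?s - 1) -` \<theta>" if \<eta>: "\<eta> \<in> D" for \<eta>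
  proof (rule dyck_tile_eq_vimage_contract[OF tile[OF \<eta>]])
    fix a b assume ab: "(a, b) \<in> \<eta>"
    then have cell: "depth lam (a, b) \<le> 0" "0 < depth ?\<mu> (a, b)" using Un \<eta> by auto
    {
      assume "a + b = ?s - 1 + 1"
      then show "(a, b - 1) \<in> \<eta> \<and> (a + 1, b) \<in> \<eta>" using through[OF \<eta> ab] by simp
    next
      assume c: "a + b = ?s - 1"
      have e: "a + b + 1 = ?s" "a + (b + 1) + 1 = ?s + 1" using c by auto
      have "(a, b + 1) \<in> \<Union>D"
        unfolding Un using cell steps ups_mu by (simp add: depth_def e)
      then obtain \<theta> where \<theta>: "\<theta> \<in> D" "(a, b + 1) \<in> \<theta>" by blast
      then have "(a, b) \<in> \<theta>" using through[OF \<theta>] c by simp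
      then show "(a, b + 1) \<in> \<eta>" using same[OF \<eta> \<theta>(1) ab] \<theta>(2) by simp
    next
      assume c: "a + b = ?s - 1 + 2"
      have e: "a + b + 1 = ?s + 1 + 1" "a - 1 + b + 1 = ?s + 1" "?s + 2 = ?s + 1 + 1" using c by auto
      have "(a - 1, b) \<in> \<Union>D"
        unfolding Un using cell steps ups_mu unfolding depth_def fst_conv snd_conv mem_Collect_eq e by simp
      then obtain \<theta> where \<theta>: "\<theta> \<in> D" "(a - 1, b) \<in> \<theta>" by blast
      then have "(a, b) \<in> \<theta>" using through[OF \<theta>] c by simp
      then show "(a - 1, b) \<in> \<eta>" using same[OF \<eta> \<theta>(1) ab] \<theta>(2) by simp
    }
  qed
  then obtain f where f: "\<And>\<eta>. \<eta> \<in> D \<Longrightarrow> dyck_tile (f \<eta>) \<and> \<eta> = contract (?s - 1) -` f \<eta>" by metis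
  have D: "D = (-`) (contract (?s - 1)) ` f ` D"
    using f by (force simp: image_image)
  have "dyck_tiling n (v' @ w') (v @ w) (f ` D)"
    using dyck_tiling_insert_peak[OF v', of "f ` D" "?s - 1" n w' w] f T unfolding split D[symmetric] by blast
  then show thesis using that[OF v' split D] by blast
qed

section \<open>Symmetric paths and tilings\<close>

fun opposite :: "step \<Rightarrow> step" where
  "opposite Up = Down" | "opposite Down = Up"

text \<open>The word of the path reflected along \<open>x + y = n\<close>. Thus a symmetric path of length \<open>2 * n\<close> is
  \<open>w @ mirror w\<close>, where \<open>w\<close> consists of its first \<open>n\<close> steps.\<close>

definition mirror :: "step list \<Rightarrow> step list" where
  "mirror w = rev (map opposite w)"

lemma opposite_opposite [simp]: "opposite (opposite s) = s"
  by (cases s) auto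

lemma mirror_simps [simp]:
  "mirror [] = []" "mirror (s # w) = mirror w @ [opposite s]" "mirror (v @ w) = mirror w @ mirror v"
  "mirror (mirror w) = w" "length (mirror w) = length w"
  by (auto simp: mirror_def rev_map comp_def)

lemma ups_mirror:
  "0 \<le> i \<Longrightarrow> i \<le> int (length w) \<Longrightarrow>
     ups (mirror w) i = i - ups w (int (length w)) + ups w (int (length w) - i)"
proof (induction w arbitrary: i)
  case (Cons s w)
  show ?case
  proof (cases "i \<le> int (length w)")
    case True
    then show ?thesis using Cons by (auto simp: ups_append ups_Cons)
  next
    case False
    then have "i = int (length w) + 1" using Cons.prems by simp
    then show ?thesis using Cons.IH[of "int (length w)"]
      by (cases s) (auto simp: ups_append ups_Cons)
  qed
qed (simp add: ups_def)

lemma lattice_points_inject: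
  assumes "length v = length w" "lattice_points v = lattice_points w"
  shows "v = w"
proof (rule nth_equalityI)
  have eq: "ups v i = ups w i" if "0 \<le> i" "i \<le> int (length v)" for i
  proof -
    have "(i - ups v i, ups v i) \<in> lattice_points w"
      unfolding assms(2)[symmetric] using that by (simp add: mem_lattice_points)
    then show ?thesis by (simp add: mem_lattice_points)
  qed
  fix i assume "i < length v"
  then have "v ! i = Up \<longleftrightarrow> w ! i = Up"
    using eq[of "int i"] eq[of "int i + 1"] ups_step[of "int i" v] ups_step[of "int i" w] assms(1)
    by (auto split: if_splits)
  then show "v ! i = w ! i" by (cases "v ! i"; cases "w ! i") auto
qed (fact assms(1))

lemma lattice_points_mirror:
  assumes "dyck_path n w"
  shows "reflect_point n ` lattice_points w = lattice_points (mirror w)"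
proof -
  have len: "int (length w) = 2 * int n" "ups w (2 * int n) = int n"
    using assms by (auto simp: dyck_path_iff)
  have "(x, y) \<in> reflect_point n ` lattice_points w \<longleftrightarrow> (x, y) \<in> lattice_points (mirror w)" for x y
  proof -
    have "(x, y) \<in> reflect_point n ` lattice_points w \<longleftrightarrow> (int n - y, int n - x) \<in> lattice_points w"
      by (force simp: image_iff)
    also have "\<dots> \<longleftrightarrow> 0 \<le> x + y \<and> x + y \<le> 2 * int n \<and> int n - x = ups w (2 * int n - (x + y))"
    proof -
      have e: "int n - y + (int n - x) = 2 * int n - (x + y)" by simp
      show ?thesis unfolding mem_lattice_points len e by auto
    qed
    also have "\<dots> \<longleftrightarrow> (x, y) \<in> lattice_points (mirror w)"
      using ups_mirror[of "x + y" w] len by (auto simp: mem_lattice_points)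
    finally show ?thesis .
  qed
  then show ?thesis by (rule set_eq_pairI)
qed

lemma sym_dyck_path_iff: "sym_dyck_path n w \<longleftrightarrow> dyck_path n w \<and> mirror w = w"
  unfolding sym_dyck_path_def
  using lattice_points_mirror[of n w] lattice_points_inject[of "mirror w" w]
  by (metis mirror_simps(5))

lemma sym_dyck_tilings_iff:
  assumes "mirror \<mu> = \<mu>"
  shows "D \<in> sym_dyck_tilings n \<mu> \<longleftrightarrow>
     (\<exists>lam. mirror lam = lam \<and> dyck_tiling n lam \<mu> D) \<and> (`) (reflect_cell n) ` D = D"
  unfolding sym_dyck_tilings_def sym_dyck_tiling_def sym_dyck_path_iff mem_Collect_eq
  using assms by (metis dyck_tiling_def)

lemma reflect_cell_reflect_cell [simp]: "reflect_cell n (reflect_cell n c) = c"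
  by (cases c) auto

lemma image_reflect_cell: "reflect_cell n ` X = reflect_cell n -` X"
proof (intro set_eqI iffI)
  fix c assume "c \<in> reflect_cell n -` X"
  then have "reflect_cell n (reflect_cell n c) \<in> reflect_cell n ` X" by (intro imageI) simp
  then show "c \<in> reflect_cell n ` X" by simp
qed (metis imageE reflect_cell_reflect_cell vimageI)

lemma inj_reflect_cell: "inj (reflect_cell n)"
  by (metis injI reflect_cell_reflect_cell)

lemma reflect_peak_cell:
  assumes "dyck_path n (v @ Up # Down # w)"
  shows "reflect_cell n (peak_cell v) = peak_cell (mirror w)"
proof -
  have "count_list (mirror u) s = count_list u (opposite s)" for u s
  proof (induction u)
    case (Cons r u)
    then show ?case by (cases r; cases s) auto
  qed simp
  moreover have "count_list (v @ Up # Down # w) Up = n" "count_list (v @ Up # Down # w) Down = n"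
    using assms by (auto simp: dyck_path_def pt_def)
  ultimately show ?thesis by (simp add: peak_cell_def)
qed

lemma finite_dyck_tiling: "dyck_tiling n lam \<mu> D \<Longrightarrow> finite D"
  by (rule finite_elements[OF finite_region, of lam \<mu>]) (simp add: dyck_tiling_def)

section \<open>Position of the tiles relative to the center line\<close>

definition left_of :: "int \<Rightarrow> cell set \<Rightarrow> bool" where
  "left_of m \<eta> \<longleftrightarrow> (\<forall>c\<in>\<eta>. fst c + snd c < m)"

definition meets :: "int \<Rightarrow> cell set \<Rightarrow> bool" where
  "meets m \<eta> \<longleftrightarrow> (\<exists>c\<in>\<eta>. fst c + snd c = m)"

lemma tiles_plus_left_of: "tiles_plus n D = card {\<eta>\<in>D. left_of (int n - 1) \<eta>}"
proof -
  have "fst c + snd c + 2 \<le> int n \<longleftrightarrow> fst c + snd c < int n - 1" for c :: cell by arith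
  then show ?thesis by (simp only: tiles_plus_def left_of_def case_prod_unfold)
qed

lemma tiles_zero_meets: "tiles_zero n D = card {\<eta>\<in>D. meets (int n - 1) \<eta>}"
proof -
  have "fst c + snd c < int n \<and> int n < fst c + snd c + 2 \<longleftrightarrow> fst c + snd c = int n - 1" for c :: cell
    by arith
  then show ?thesis by (simp only: tiles_zero_def meets_def case_prod_unfold)
qed

text \<open>The content of \<open>contract p c\<close> as a function of the content of \<open>c\<close>.\<close>

definition contract_level :: "int \<Rightarrow> int \<Rightarrow> int" where
  "contract_level p m = (if m \<le> p then m else if m = p + 1 then m - 1 else m - 2)"

lemma content_contract: "fst (contract p c) + snd (contract p c) = contract_level p (fst c + snd c)"
  by (cases c) (simp add: contract_level_def)

text \<open>Since \<open>contract p\<close> is onto and monotone in the content, inserting a peak into a tile keeps its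
  position relative to the center line, which moves from \<open>contract_level p m\<close> to \<open>m\<close>.\<close>

lemma left_of_meets_vimage_contract:
  shows "left_of m (contract p -` \<eta>) \<longleftrightarrow> left_of (contract_level p m) \<eta>"
    and "meets m (contract p -` \<eta>) \<longleftrightarrow> meets (contract_level p m) \<eta>"
proof -
  have mono: "contract_level p m \<le> contract_level p k" if "m \<le> k" for k
    using that by (auto simp: contract_level_def)
  have top: "\<exists>c. contract p c = d \<and> m \<le> fst c + snd c" if "contract_level p m \<le> fst d + snd d" for d
  proof (cases "fst d + snd d < p")
    case True
    then show ?thesis using that
      by (intro exI[of _ d]) (cases d; auto simp: contract_level_def split: if_splits)
  next
    case False
    then show ?thesis using that
      by (intro exI[of _ "(fst d + 1, snd d + 1)"]) (auto simp: contract_level_def split: if_splits)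
  qed
  have exact: "\<exists>c. contract p c = d \<and> fst c + snd c = m" if "fst d + snd d = contract_level p m" for d
  proof -
    consider "m \<le> p" | "m = p + 1" | "p + 2 \<le> m" by linarith
    then show ?thesis
    proof cases
      case 1
      then show ?thesis using that by (intro exI[of _ d]) (cases d; simp add: contract_level_def)
    next
      case 2
      then show ?thesis using that
        by (intro exI[of _ "(fst d, snd d + 1)"]) (cases d; simp add: contract_level_def)
    next
      case 3
      then show ?thesis using that
        by (intro exI[of _ "(fst d + 1, snd d + 1)"]) (cases d; simp add: contract_level_def)
    qed
  qed
  show "left_of m (contract p -` \<eta>) \<longleftrightarrow> left_of (contract_level p m) \<eta>"
    unfolding left_of_def
  proof (intro iffI ballI)
    fix d assume *: "\<forall>c\<in>contract p -` \<eta>. fst c + snd c < m" "d \<in> \<eta>"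
    show "fst d + snd d < contract_level p m"
    proof (rule ccontr)
      assume "\<not> fst d + snd d < contract_level p m"
      then obtain c where "contract p c = d" "m \<le> fst c + snd c" using top[of d] by auto
      moreover from this have "c \<in> contract p -` \<eta>" using *(2) by (simp only: vimage_eq)
      then have "fst c + snd c < m" by (rule bspec[OF *(1)])
      ultimately show False by linarith
    qed
  next
    fix c assume *: "\<forall>d\<in>\<eta>. fst d + snd d < contract_level p m" "c \<in> contract p -` \<eta>"
    then have "contract_level p (fst c + snd c) < contract_level p m"
      unfolding content_contract[symmetric] by (simp only: vimage_eq)
    then show "fst c + snd c < m" using mono[of "fst c + snd c"] by linarith
  qed
  show "meets m (contract p -` \<eta>) \<longleftrightarrow> meets (contract_level p m) \<eta>"
    unfolding meets_def
  proof
    assume "\<exists>c\<in>contract p -` \<eta>. fst c + snd c = m"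
    then show "\<exists>d\<in>\<eta>. fst d + snd d = contract_level p m"
      using content_contract by (metis vimage_eq)
  next
    assume "\<exists>d\<in>\<eta>. fst d + snd d = contract_level p m"
    then show "\<exists>c\<in>contract p -` \<eta>. fst c + snd c = m"
      using exact by (metis vimage_eq)
  qed
qed

lemma card_vimage:
  assumes "surj f"
  shows "card {\<eta> \<in> (-`) f ` D. P \<eta>} = card {\<eta> \<in> D. P (f -` \<eta>)}"
proof -
  have "{\<eta> \<in> (-`) f ` D. P \<eta>} = (-`) f ` {\<eta> \<in> D. P (f -` \<eta>)}" by auto
  moreover have "inj_on ((-`) f) X" for X
    using surj_vimage_iff(1)[OF assms] by (auto intro: inj_onI)
  ultimately show ?thesis by (simp add: card_image)
qed

definition weight :: "'a::comm_ring_1 \<Rightarrow> 'a \<Rightarrow> nat \<Rightarrow> cell set set \<Rightarrow> 'a" where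
  "weight q t n D = q ^ (tiles_plus n D + tiles_zero n D) * t ^ tiles_zero n D"

section \<open>Removing and contracting peaks symmetrically\<close>

lemma image_reflect_vimage:
  assumes "f \<circ> reflect_cell m = reflect_cell n \<circ> f"
  shows "reflect_cell m ` (f -` X) = f -` (reflect_cell n ` X)"
  unfolding image_reflect_cell vimage_comp assms ..

lemma reflect_vimage_iff:
  assumes "surj f" "f \<circ> reflect_cell m = reflect_cell n \<circ> f"
  shows "(`) (reflect_cell m) ` (-`) f ` D = (-`) f ` D \<longleftrightarrow> (`) (reflect_cell n) ` D = D"
proof -
  have "(`) (reflect_cell m) ` (-`) f ` D = (-`) f ` (`) (reflect_cell n) ` D"
    by (simp only: image_image image_reflect_vimage[OF assms(2)])
  moreover have "inj ((-`) f)"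
    using surj_vimage_iff(1)[OF assms(1)] by (auto intro: injI)
  ultimately show ?thesis by (simp add: inj_image_eq_iff)
qed

text \<open>Contracting at two diagonals that are mirror images commutes with the reflection. Contraction at
  \<open>r\<close> leaves contents up to \<open>r\<close> unchanged and lowers larger ones by at most two, and contraction at
  \<open>l\<close> does likewise; so the centre of symmetry moves from \<open>n + 1\<close> down to \<open>n - 1\<close>.\<close>

lemma reflect_contract_pair:
  assumes "l + r = 2 * int n" "l + 2 \<le> r"
  shows "contract l (contract r (reflect_cell (Suc (Suc n)) c)) = reflect_cell n (contract l (contract r c))"
proof (cases c)
  case (Pair a b)
  consider "a + b \<le> l" | "a + b = l + 1" | "l + 2 \<le> a + b" "a + b \<le> r" | "a + b = r + 1" | "r + 2 \<le> a + b"
    by linarith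
  then show ?thesis by cases (use assms Pair in auto)
qed

lemma reflect_contract_center:
  "contract (int n - 1) (reflect_cell (Suc n) c) = reflect_cell n (contract (int n - 1) c)"
proof (cases c)
  case (Pair a b)
  consider "a + b \<le> int n - 1" | "a + b = int n" | "int n + 1 \<le> a + b" by linarith
  then show ?thesis by cases (use Pair in auto)
qed

lemma mirror_append_eq:
  assumes "length c = length a"
  shows "mirror (a @ b @ c) = a @ b @ c \<longleftrightarrow> c = mirror a \<and> mirror b = b"
  using assms by (auto simp: append_eq_append_conv)

text \<open>The peak cell is merged with the cell directly below it, so no preimage is the peak cell
  alone.\<close>

lemma peak_tile_not_vimage:
  assumes "f (peak_cell v) = contract (int (length v) - 1) (peak_cell v)"
    and "f (fst (peak_cell v), snd (peak_cell v) - 1) = (fst (peak_cell v), snd (peak_cell v) - 1)"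
  shows "f -` X \<noteq> {peak_cell v}"
proof
  obtain a b where c: "peak_cell v = (a, b)" by (cases "peak_cell v")
  then have "a + b = int (length v)" using content_peak_cell[of v] by simp
  then have *: "f (a, b) = f (a, b - 1)" using assms c by simp
  assume "f -` X = {peak_cell v}"
  then have "(a, b) \<in> f -` X" "(a, b - 1) \<notin> f -` X" by (auto simp: c)
  then show False using * by simp
qed

lemma sym_dyck_tilingsE:
  assumes "D \<in> sym_dyck_tilings n \<mu>" "mirror \<mu> = \<mu>"
  obtains lam where "mirror lam = lam" "dyck_tiling n lam \<mu> D" "(`) (reflect_cell n) ` D = D"
  using assms(1) that unfolding sym_dyck_tilings_iff[OF assms(2)] by metis

lemma sym_dyck_tilingsI:
  assumes "mirror lam = lam" "dyck_tiling n lam \<mu> D" "(`) (reflect_cell n) ` D = D" "mirror \<mu> = \<mu>"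
  shows "D \<in> sym_dyck_tilings n \<mu>"
  unfolding sym_dyck_tilings_iff[OF assms(4)] using assms(1-3) by metis

text \<open>Two peaks that are mirror images of each other are treated together. By symmetry their cells
  are either both tiles, which are then removed, or neither is.\<close>

lemma bij_betw_remove_peak_pair:
  fixes x z :: "step list"
  defines "l \<equiv> peak_cell x" and "r \<equiv> peak_cell (x @ Up # Down # z)"
  assumes z: "mirror z = z"
  shows "bij_betw (\<lambda>D. insert {l} (insert {r} D))
           (sym_dyck_tilings n (x @ Down # Up # z @ Down # Up # mirror x))
           {D \<in> sym_dyck_tilings n (x @ Up # Down # z @ Up # Down # mirror x). {l} \<in> D}"
    (is "bij_betw ?f (sym_dyck_tilings n ?\<mu>') {D \<in> sym_dyck_tilings n ?\<mu>. _}")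
    and "D \<in> sym_dyck_tilings n (x @ Down # Up # z @ Down # Up # mirror x) \<Longrightarrow> {l} \<notin> D \<and> {r} \<notin> D \<and> finite D"
proof -
  have mir: "mirror ?\<mu> = ?\<mu>" "mirror ?\<mu>' = ?\<mu>'" using z by simp_all
  have lr: "l \<noteq> r"
    using content_peak_cell[of x] content_peak_cell[of "x @ Up # Down # z"] by (auto simp: l_def r_def)
  have refl: "reflect_cell n l = r" "reflect_cell n r = l" if "dyck_path n ?\<mu>"
  proof -
    show "reflect_cell n l = r" using reflect_peak_cell[OF that] z by (simp add: l_def r_def)
    then show "reflect_cell n r = l" by (metis reflect_cell_reflect_cell)
  qed
  have add: "?f D \<in> sym_dyck_tilings n ?\<mu> \<and> {l} \<notin> D \<and> {r} \<notin> D \<and> finite D"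
    if mem: "D \<in> sym_dyck_tilings n ?\<mu>'" for D
  proof -
    obtain lam where lam: "mirror lam = lam" and T: "dyck_tiling n lam ?\<mu>' D"
      and D: "(`) (reflect_cell n) ` D = D"
      by (rule sym_dyck_tilingsE[OF mem mir(2)])
    have T1: "dyck_tiling n lam ((x @ Up # Down # z) @ Down # Up # mirror x) (insert {l} D)" "l \<notin> \<Union>D"
      using add_peak_tile[OF T] by (simp_all add: l_def)
    have T2: "dyck_tiling n lam ?\<mu> (insert {r} (insert {l} D))" "r \<notin> \<Union>(insert {l} D)"
      using add_peak_tile[OF T1(1)] by (simp_all add: r_def)
    have "dyck_path n ?\<mu>" using T2(1) by (simp add: dyck_tiling_def)
    then have "(`) (reflect_cell n) ` ?f D = ?f D"
      using D refl by (simp add: insert_commute)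
    moreover have "dyck_tiling n lam ?\<mu> (?f D)" using T2(1) by (simp add: insert_commute)
    ultimately have "?f D \<in> sym_dyck_tilings n ?\<mu>"
      using sym_dyck_tilingsI[OF lam _ _ mir(1)] by simp
    then show ?thesis using T1(2) T2(2) finite_dyck_tiling[OF T] by (intro conjI) auto
  qed
  have remove: "D - {{l}, {r}} \<in> sym_dyck_tilings n ?\<mu>' \<and> {r} \<in> D"
    if mem: "D \<in> sym_dyck_tilings n ?\<mu>" and l: "{l} \<in> D" for D
  proof -
    obtain lam where lam: "mirror lam = lam" and T: "dyck_tiling n lam ?\<mu> D"
      and D: "(`) (reflect_cell n) ` D = D"
      by (rule sym_dyck_tilingsE[OF mem mir(1)])
    have dyck: "dyck_path n ?\<mu>" using T by (simp add: dyck_tiling_def)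
    have "reflect_cell n ` {l} \<in> (`) (reflect_cell n) ` D" using l by (rule imageI)
    then have r: "{r} \<in> D" using D refl[OF dyck] by simp
    have "dyck_tiling n lam ((x @ Up # Down # z) @ Down # Up # mirror x) (D - {{r}})"
      using remove_peak_tile[of n lam "x @ Up # Down # z" "mirror x" D] T r by (simp add: r_def)
    then have "dyck_tiling n lam ?\<mu>' (D - {{r}} - {{l}})"
      using remove_peak_tile[of n lam x "z @ Down # Up # mirror x" "D - {{r}}"] l lr by (simp add: l_def)
    moreover have eq: "D - {{r}} - {{l}} = D - {{l}, {r}}" by blast
    moreover have "inj ((`) (reflect_cell n))" by (rule injI) (simp add: inj_image_eq_iff[OF inj_reflect_cell])
    then have "(`) (reflect_cell n) ` (D - {{l}, {r}}) = D - {{l}, {r}}"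
      using D refl[OF dyck] by (simp add: image_set_diff insert_commute)
    ultimately show ?thesis using sym_dyck_tilingsI[OF lam _ _ mir(2)] r by simp
  qed
  show "bij_betw ?f (sym_dyck_tilings n ?\<mu>') {D \<in> sym_dyck_tilings n ?\<mu>. {l} \<in> D}"
  proof (rule bij_betw_byWitness[where f' = "\<lambda>D. D - {{l}, {r}}"]; intro ballI image_subsetI)
    fix D assume "D \<in> sym_dyck_tilings n ?\<mu>'"
    note * = add[OF this]
    show "?f D - {{l}, {r}} = D" using * by auto
    show "?f D \<in> {D \<in> sym_dyck_tilings n ?\<mu>. {l} \<in> D}" using * by simp
  next
    fix D assume "D \<in> {D \<in> sym_dyck_tilings n ?\<mu>. {l} \<in> D}"
    then have *: "D \<in> sym_dyck_tilings n ?\<mu>" "{l} \<in> D" by simp_all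
    show "?f (D - {{l}, {r}}) = D" using remove[OF *] *(2) by auto
    show "D - {{l}, {r}} \<in> sym_dyck_tilings n ?\<mu>'" using remove[OF *] by simp
  qed
  show "D \<in> sym_dyck_tilings n ?\<mu>' \<Longrightarrow> {l} \<notin> D \<and> {r} \<notin> D \<and> finite D" using add by simp
qed

lemma bij_betw_remove_center_peak:
  fixes x :: "step list"
  defines "c \<equiv> peak_cell x"
  shows "bij_betw (insert {c}) (sym_dyck_tilings n (x @ Down # Up # mirror x))
           {D \<in> sym_dyck_tilings n (x @ Up # Down # mirror x). {c} \<in> D}"
    (is "bij_betw _ (sym_dyck_tilings n ?\<mu>') {D \<in> sym_dyck_tilings n ?\<mu>. _}")
    and "D \<in> sym_dyck_tilings n (x @ Down # Up # mirror x) \<Longrightarrow> {c} \<notin> D \<and> finite D"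
proof -
  have mir: "mirror ?\<mu> = ?\<mu>" "mirror ?\<mu>' = ?\<mu>'" by simp_all
  have refl: "reflect_cell n c = c" if "dyck_path n ?\<mu>"
    using reflect_peak_cell[OF that] by (simp add: c_def)
  have add: "insert {c} D \<in> sym_dyck_tilings n ?\<mu> \<and> {c} \<notin> D \<and> finite D"
    if mem: "D \<in> sym_dyck_tilings n ?\<mu>'" for D
  proof -
    obtain lam where lam: "mirror lam = lam" and T: "dyck_tiling n lam ?\<mu>' D"
      and D: "(`) (reflect_cell n) ` D = D"
      by (rule sym_dyck_tilingsE[OF mem mir(2)])
    have T1: "dyck_tiling n lam ?\<mu> (insert {c} D)" "c \<notin> \<Union>D"
      using add_peak_tile[OF T] by (simp_all add: c_def)
    have "dyck_path n ?\<mu>" using T1(1) by (simp add: dyck_tiling_def)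
    then have "(`) (reflect_cell n) ` insert {c} D = insert {c} D"
      using D refl by simp
    then have "insert {c} D \<in> sym_dyck_tilings n ?\<mu>"
      using sym_dyck_tilingsI[OF lam T1(1) _ mir(1)] by simp
    then show ?thesis using T1(2) finite_dyck_tiling[OF T] by (intro conjI) auto
  qed
  have remove: "D - {{c}} \<in> sym_dyck_tilings n ?\<mu>'"
    if mem: "D \<in> sym_dyck_tilings n ?\<mu>" and c: "{c} \<in> D" for D
  proof -
    obtain lam where lam: "mirror lam = lam" and T: "dyck_tiling n lam ?\<mu> D"
      and D: "(`) (reflect_cell n) ` D = D"
      by (rule sym_dyck_tilingsE[OF mem mir(1)])
    have dyck: "dyck_path n ?\<mu>" using T by (simp add: dyck_tiling_def)
    have "dyck_tiling n lam ?\<mu>' (D - {{c}})"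
      using remove_peak_tile[OF T] c by (simp add: c_def)
    moreover have "inj ((`) (reflect_cell n))" by (rule injI) (simp add: inj_image_eq_iff[OF inj_reflect_cell])
    then have "(`) (reflect_cell n) ` (D - {{c}}) = D - {{c}}"
      using D refl[OF dyck] by (simp add: image_set_diff)
    ultimately show ?thesis using sym_dyck_tilingsI[OF lam _ _ mir(2)] by simp
  qed
  show "bij_betw (insert {c}) (sym_dyck_tilings n ?\<mu>') {D \<in> sym_dyck_tilings n ?\<mu>. {c} \<in> D}"
  proof (rule bij_betw_byWitness[where f' = "\<lambda>D. D - {{c}}"]; intro ballI image_subsetI)
    fix D assume "D \<in> sym_dyck_tilings n ?\<mu>'"
    note * = add[OF this]
    show "insert {c} D - {{c}} = D" using * by auto
    show "insert {c} D \<in> {D \<in> sym_dyck_tilings n ?\<mu>. {c} \<in> D}" using * by simp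
  next
    fix D assume "D \<in> {D \<in> sym_dyck_tilings n ?\<mu>. {c} \<in> D}"
    then have *: "D \<in> sym_dyck_tilings n ?\<mu>" "{c} \<in> D" by simp_all
    show "insert {c} (D - {{c}}) = D" using *(2) by auto
    show "D - {{c}} \<in> sym_dyck_tilings n ?\<mu>'" using remove[OF *] by simp
  qed
  show "D \<in> sym_dyck_tilings n ?\<mu>' \<Longrightarrow> {c} \<notin> D \<and> finite D" using add by simp
qed

text \<open>If the cell below the central peak is not a tile by itself, contraction there
  yields a symmetric tiling again, and all arise so.\<close>

lemma bij_betw_contract_center_peak:
  fixes x :: "step list"
  defines "n \<equiv> length x"
  defines "f \<equiv> contract (int n - 1)"
  shows "bij_betw ((`) ((-`) f)) (sym_dyck_tilings n (x @ mirror x))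
           {D \<in> sym_dyck_tilings (Suc n) (x @ Up # Down # mirror x). {peak_cell x} \<notin> D}"
    (is "bij_betw ?F (sym_dyck_tilings n ?\<mu>') {D \<in> sym_dyck_tilings _ ?\<mu>. _}")
proof -
  have mir: "mirror ?\<mu> = ?\<mu>" "mirror ?\<mu>' = ?\<mu>'" by simp_all
  have surj: "surj f" unfolding f_def by (rule surj_contract)
  have comm: "f \<circ> reflect_cell (Suc n) = reflect_cell n \<circ> f"
    by (rule ext) (simp only: f_def comp_apply reflect_contract_center)
  have lift: "?F D \<in> sym_dyck_tilings (Suc n) ?\<mu> \<and> {peak_cell x} \<notin> ?F D"
    if mem: "D \<in> sym_dyck_tilings n ?\<mu>'" for D
  proof -
    obtain lam where lam: "mirror lam = lam" and T: "dyck_tiling n lam ?\<mu>' D"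
      and D: "(`) (reflect_cell n) ` D = D"
      by (rule sym_dyck_tilingsE[OF mem mir(2)])
    have "length lam = 2 * n" using T by (simp add: dyck_tiling_def dyck_path_def)
    then have len: "length (take n lam) = n" "length (drop n lam) = n" by auto
    have d: "drop n lam = mirror (take n lam)"
      using mirror_append_eq[of "drop n lam" "take n lam" "[]"] lam len by simp
    have "dyck_tiling (Suc n) (take n lam @ Up # Down # drop n lam) ?\<mu> (?F D)"
      using dyck_tiling_insert_peak[of "take n lam" x D "int n - 1" n "drop n lam" "mirror x"] T len
      by (simp add: f_def n_def dyck_tiling_def)
    moreover have "mirror (take n lam @ Up # Down # drop n lam) = take n lam @ Up # Down # drop n lam"
      by (simp add: d)
    ultimately have "?F D \<in> sym_dyck_tilings (Suc n) ?\<mu>"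
      using sym_dyck_tilingsI[OF _ _ iffD2[OF reflect_vimage_iff[OF surj comm] D] mir(1)] by blast
    moreover have "{peak_cell x} \<notin> ?F D"
      using peak_tile_not_vimage[of f x] content_peak_cell[of x] by (auto simp: f_def n_def)
    ultimately show ?thesis by simp
  qed
  have lower: "\<exists>D'\<in>sym_dyck_tilings n ?\<mu>'. D = ?F D'"
    if D: "D \<in> sym_dyck_tilings (Suc n) ?\<mu>" and peak: "{peak_cell x} \<notin> D" for D
  proof -
    obtain lam where lam: "mirror lam = lam" and T: "dyck_tiling (Suc n) lam ?\<mu> D"
      and refl_D: "(`) (reflect_cell (Suc n)) ` D = D"
      by (rule sym_dyck_tilingsE[OF D mir(1)])
    obtain v w D' where D': "length v = length x" "lam = v @ Up # Down # w" "D = ?F D'"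
        "dyck_tiling n (v @ w) ?\<mu>' D'"
      using contract_peak[OF T peak] unfolding f_def n_def by blast
    have "length lam = 2 * Suc n" using T by (simp add: dyck_tiling_def dyck_path_def)
    then have "length w = length v" using D'(1,2) n_def by simp
    then have "w = mirror v"
      using mirror_append_eq[of w v "[Up, Down]"] lam D'(2) by simp
    then have "mirror (v @ w) = v @ w" by simp
    moreover have "(`) (reflect_cell n) ` D' = D'"
      using refl_D unfolding D'(3) reflect_vimage_iff[OF surj comm] .
    ultimately have "D' \<in> sym_dyck_tilings n ?\<mu>'" by (rule sym_dyck_tilingsI[OF _ D'(4) _ mir(2)])
    then show ?thesis using D'(3) by (rule bexI[rotated])
  qed
  have "inj_on ?F (sym_dyck_tilings n ?\<mu>')"
    by (intro inj_on_image inj_onI) (simp add: surj_vimage_iff(1)[OF surj])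
  moreover have "?F ` sym_dyck_tilings n ?\<mu>' = {D \<in> sym_dyck_tilings (Suc n) ?\<mu>. {peak_cell x} \<notin> D}"
  proof (intro set_eqI iffI)
    fix D assume "D \<in> ?F ` sym_dyck_tilings n ?\<mu>'"
    then show "D \<in> {D \<in> sym_dyck_tilings (Suc n) ?\<mu>. {peak_cell x} \<notin> D}" using lift by (elim imageE) simp
  next
    fix D assume "D \<in> {D \<in> sym_dyck_tilings (Suc n) ?\<mu>. {peak_cell x} \<notin> D}"
    then have "\<exists>D'\<in>sym_dyck_tilings n ?\<mu>'. D = ?F D'" using lower by simp
    then show "D \<in> ?F ` sym_dyck_tilings n ?\<mu>'" by (elim bexE) (rule image_eqI)
  qed
  ultimately show ?thesis by (simp only: bij_betw_def)
qed

text \<open>The right peak is contracted first, because this does not move the left one: every cell near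
  the left peak has content at most \<open>length x + 1\<close>, and the right contraction only
  moves contents above \<open>length x + length z + 1\<close>.\<close>

lemma bij_betw_contract_peak_pair:
  fixes x z :: "step list"
  assumes z: "mirror z = z" and n: "2 * n = 2 * length x + length z"
  defines "f \<equiv> contract (int (length x) - 1) \<circ> contract (int (length x + length z) + 1)"
  shows "bij_betw ((`) ((-`) f)) (sym_dyck_tilings n (x @ z @ mirror x))
           {D \<in> sym_dyck_tilings (Suc (Suc n)) (x @ Up # Down # z @ Up # Down # mirror x). {peak_cell x} \<notin> D}"
    (is "bij_betw ?F (sym_dyck_tilings n ?\<mu>') {D \<in> sym_dyck_tilings _ ?\<mu>. _}")
proof -
  let ?l = "int (length x) - 1" and ?r = "int (length x + length z) + 1"
  let ?x = "x @ Up # Down # z"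
  have r: "int (length ?x) - 1 = ?r" by simp
  have mir: "mirror ?\<mu> = ?\<mu>" "mirror ?\<mu>' = ?\<mu>'" using z by simp_all
  have surj: "surj f" unfolding f_def by (intro comp_surj surj_contract)
  have comm: "f \<circ> reflect_cell (Suc (Suc n)) = reflect_cell n \<circ> f"
    using reflect_contract_pair[of ?l ?r n] n by (intro ext) (simp add: f_def del: reflect_cell.simps contract.simps)
  have F: "?F D = (-`) (contract ?r) ` (-`) (contract ?l) ` D" for D
    by (simp add: image_image vimage_comp f_def)
  have lift: "?F D \<in> sym_dyck_tilings (Suc (Suc n)) ?\<mu> \<and> {peak_cell x} \<notin> ?F D"
    if mem: "D \<in> sym_dyck_tilings n ?\<mu>'" for D
  proof -
    obtain lam where lam: "mirror lam = lam" and T: "dyck_tiling n lam ?\<mu>' D"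
      and D: "(`) (reflect_cell n) ` D = D"
      by (rule sym_dyck_tilingsE[OF mem mir(2)])
    define a b c where "a = take (length x) lam" and "b = take (length z) (drop (length x) lam)"
      and "c = drop (length z) (drop (length x) lam)"
    have split: "lam = a @ b @ c" by (simp only: a_def b_def c_def append_take_drop_id)
    have "length lam = 2 * n" using T by (simp add: dyck_tiling_def dyck_path_def)
    then have len: "length a = length x" "length b = length z" "length c = length a"
      using n by (auto simp: a_def b_def c_def)
    have mir': "c = mirror a" "mirror b = b"
      using mirror_append_eq[OF len(3), of b] lam split by auto
    have tiles: "\<forall>\<eta>\<in>D. dyck_tile \<eta>" using T by (simp add: dyck_tiling_def)
    then have tiles': "\<forall>\<eta>\<in>(-`) (contract ?l) ` D. dyck_tile \<eta>" using dyck_tile_vimage_contract by blast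
    have "dyck_tiling (Suc n) (a @ Up # Down # (b @ c)) (x @ Up # Down # (z @ mirror x)) ((-`) (contract ?l) ` D)"
      using dyck_tiling_insert_peak[OF len(1) tiles refl, of n "b @ c" "z @ mirror x"] T split by simp
    moreover have "length (a @ Up # Down # b) = length ?x" using len by simp
    ultimately have "dyck_tiling (Suc (Suc n)) ((a @ Up # Down # b) @ Up # Down # c) (?x @ Up # Down # mirror x) (?F D)"
      using dyck_tiling_insert_peak[of "a @ Up # Down # b" ?x _ ?r "Suc n" c "mirror x", OF _ tiles' r[symmetric]]
      unfolding F by simp
    then have "dyck_tiling (Suc (Suc n)) (a @ Up # Down # b @ Up # Down # c) ?\<mu> (?F D)" by simp
    moreover have "mirror (a @ Up # Down # b @ Up # Down # c) = a @ Up # Down # b @ Up # Down # c"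
      by (simp add: mir')
    ultimately have "?F D \<in> sym_dyck_tilings (Suc (Suc n)) ?\<mu>"
      using sym_dyck_tilingsI[OF _ _ iffD2[OF reflect_vimage_iff[OF surj comm] D] mir(1)] by blast
    moreover have "f -` X \<noteq> {peak_cell x}" for X
      by (rule peak_tile_not_vimage; use content_peak_cell[of x] in \<open>cases "peak_cell x"\<close>) (simp_all add: f_def)
    then have "{peak_cell x} \<notin> ?F D" by (metis imageE)
    ultimately show ?thesis by simp
  qed
  have lower: "\<exists>D'\<in>sym_dyck_tilings n ?\<mu>'. D = ?F D'"
    if D: "D \<in> sym_dyck_tilings (Suc (Suc n)) ?\<mu>" and peak: "{peak_cell x} \<notin> D" for D
  proof -
    obtain lam where lam: "mirror lam = lam" and T: "dyck_tiling (Suc (Suc n)) lam ?\<mu> D"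
      and refl_D: "(`) (reflect_cell (Suc (Suc n))) ` D = D"
      by (rule sym_dyck_tilingsE[OF D mir(1)])
    have T': "dyck_tiling (Suc (Suc n)) lam (?x @ Up # Down # mirror x) D" using T by simp
    have "reflect_cell (Suc (Suc n)) (peak_cell x) = peak_cell ?x"
      using reflect_peak_cell[of "Suc (Suc n)" x "z @ Up # Down # mirror x"] T z by (simp add: dyck_tiling_def)
    then have "reflect_cell (Suc (Suc n)) (peak_cell ?x) = peak_cell x"
      by (metis reflect_cell_reflect_cell)
    then have "{peak_cell x} \<in> (`) (reflect_cell (Suc (Suc n))) ` D" if "{peak_cell ?x} \<in> D"
      using imageI[OF that, of "(`) (reflect_cell (Suc (Suc n)))"] by simp
    then have "{peak_cell ?x} \<notin> D" using refl_D peak by auto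
    then obtain v c D1 where D1: "length v = length ?x" "lam = v @ Up # Down # c" "D = (-`) (contract ?r) ` D1"
        "dyck_tiling (Suc n) (v @ c) (?x @ mirror x) D1"
      using contract_peak[OF T'] unfolding r by metis
    have fixed: "contract ?r -` {peak_cell x} = {peak_cell x}"
      using content_peak_cell[of x]
      by (intro vimage_contract_trivial(1)) (cases "peak_cell x"; simp)
    have "{peak_cell x} \<notin> D1"
    proof
      assume "{peak_cell x} \<in> D1"
      then have "contract ?r -` {peak_cell x} \<in> D" unfolding D1(3) by (rule imageI)
      then show False using peak fixed by simp
    qed
    moreover have "dyck_tiling (Suc n) (v @ c) (x @ Up # Down # z @ mirror x) D1" using D1(4) by simp
    ultimately obtain a w D2 where D2: "length a = length x" "v @ c = a @ Up # Down # w"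
        "D1 = (-`) (contract ?l) ` D2" "dyck_tiling n (a @ w) (x @ z @ mirror x) D2"
      using contract_peak by metis
    \<comment> \<open>The left contraction found \<open>Up # Down\<close> after \<open>a\<close> in \<open>v @ c\<close>; as \<open>v\<close> is long enough, both
      steps belong to \<open>v\<close>.\<close>
    define b where "b = drop (length x + 2) v"
    have v: "v = a @ Up # Down # b"
    proof -
      have "take (length x + 2) (v @ c) = a @ [Up, Down]" unfolding D2(2) using D2(1) by simp
      then have "take (length x + 2) v = a @ [Up, Down]" using D1(1) by simp
      then show ?thesis unfolding b_def using append_take_drop_id[of "length x + 2" v] by simp
    qed
    then have w: "w = b @ c" using D2(2) by simp
    have "length lam = 2 * Suc (Suc n)" using T by (simp add: dyck_tiling_def dyck_path_def)
    then have "length c = length a" using D1(1,2) D2(1) n by simp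
    moreover have "lam = a @ (Up # Down # b @ [Up, Down]) @ c" using D1(2) v by simp
    ultimately have "c = mirror a" "mirror b = b"
      using mirror_append_eq[of c a "Up # Down # b @ [Up, Down]"] lam by auto
    then have "mirror (a @ w) = a @ w" by (simp add: w)
    moreover have "(`) (reflect_cell n) ` D2 = D2"
      using refl_D unfolding D1(3) D2(3) F[symmetric] reflect_vimage_iff[OF surj comm] .
    ultimately have "D2 \<in> sym_dyck_tilings n ?\<mu>'" by (rule sym_dyck_tilingsI[OF _ D2(4) _ mir(2)])
    moreover have "D = ?F D2" unfolding D1(3) D2(3) F ..
    ultimately show ?thesis by (rule bexI[rotated])
  qed
  have "inj_on ?F (sym_dyck_tilings n ?\<mu>')"
    by (intro inj_on_image inj_onI) (simp add: surj_vimage_iff(1)[OF surj])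
  moreover have "?F ` sym_dyck_tilings n ?\<mu>' = {D \<in> sym_dyck_tilings (Suc (Suc n)) ?\<mu>. {peak_cell x} \<notin> D}"
  proof (intro set_eqI iffI)
    fix D assume "D \<in> ?F ` sym_dyck_tilings n ?\<mu>'"
    then show "D \<in> {D \<in> sym_dyck_tilings (Suc (Suc n)) ?\<mu>. {peak_cell x} \<notin> D}" using lift by (elim imageE) simp
  next
    fix D assume "D \<in> {D \<in> sym_dyck_tilings (Suc (Suc n)) ?\<mu>. {peak_cell x} \<notin> D}"
    then have "\<exists>D'\<in>sym_dyck_tilings n ?\<mu>'. D = ?F D'" using lower by simp
    then show "D \<in> ?F ` sym_dyck_tilings n ?\<mu>'" by (elim bexE) (rule image_eqI)
  qed
  ultimately show ?thesis by (simp only: bij_betw_def)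
qed

section \<open>Recurrences for the weighted sum\<close>

lemma weight_vimage_pair:
  assumes "2 * n = 2 * length x + length z"
  defines "f \<equiv> contract (int (length x) - 1) \<circ> contract (int (length x + length z) + 1)"
  shows "weight q t (Suc (Suc n)) ((-`) f ` D) = weight q t n D"
proof -
  have surj: "surj f" unfolding f_def by (intro comp_surj surj_contract)
  have lev: "contract_level (int (length x) - 1) (contract_level (int (length x + length z) + 1) (int n + 1)) = int n - 1"
    using assms(1) by (simp add: contract_level_def)
  have st: "left_of (int n + 1) (f -` \<eta>) \<longleftrightarrow> left_of (int n - 1) \<eta>"
    "meets (int n + 1) (f -` \<eta>) \<longleftrightarrow> meets (int n - 1) \<eta>" for \<eta>
    unfolding f_def vimage_comp[symmetric] left_of_meets_vimage_contract lev by (rule refl)+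
  have n: "int (Suc (Suc n)) - 1 = int n + 1" by simp
  show ?thesis
    unfolding weight_def tiles_plus_left_of tiles_zero_meets card_vimage[OF surj] n st ..
qed

lemma weight_vimage_center:
  "weight q t (Suc n) ((-`) (contract (int n - 1)) ` D) = weight q t n D"
proof -
  have n: "int (Suc n) - 1 = int n" by simp
  have lev: "contract_level (int n - 1) (int n) = int n - 1" by (simp add: contract_level_def)
  show ?thesis
    unfolding weight_def tiles_plus_left_of tiles_zero_meets card_vimage[OF surj_contract] n
      left_of_meets_vimage_contract lev ..
qed

lemma Collect_insert:
  "{\<eta> \<in> insert a D. P \<eta>} = (if P a then insert a {\<eta> \<in> D. P \<eta>} else {\<eta> \<in> D. P \<eta>})"
  by auto

lemma weight_insert_pair:
  assumes "{l} \<notin> D" "{r} \<notin> D" "finite D"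
    and "fst l + snd l < int n - 1" "int n - 1 < fst r + snd r"
  shows "weight q t n (insert {l} (insert {r} D)) = q * weight q t n D"
proof -
  have "tiles_plus n (insert {l} (insert {r} D)) = Suc (tiles_plus n D)"
    using assms unfolding tiles_plus_left_of Collect_insert by (auto simp: left_of_def)
  moreover have "tiles_zero n (insert {l} (insert {r} D)) = tiles_zero n D"
    using assms unfolding tiles_zero_meets Collect_insert by (auto simp: meets_def)
  ultimately show ?thesis by (simp add: weight_def mult.assoc)
qed

lemma weight_insert_center:
  assumes "{c} \<notin> D" "finite D" "fst c + snd c = int n - 1"
  shows "weight q t n (insert {c} D) = t * q * weight q t n D"
proof -
  have "tiles_plus n (insert {c} D) = tiles_plus n D"
    using assms unfolding tiles_plus_left_of Collect_insert by (auto simp: left_of_def)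
  moreover have "tiles_zero n (insert {c} D) = Suc (tiles_zero n D)"
    using assms unfolding tiles_zero_meets Collect_insert by (auto simp: meets_def)
  ultimately show ?thesis by (simp add: weight_def algebra_simps)
qed

text \<open>The left-hand side of the theorem, as a function of the first half of the path. It makes sense
  for every word \<open>w\<close>, being zero if \<open>w\<close> goes below the diagonal; hence the recurrences need
  no side conditions.\<close>

definition tiling_sum :: "'a::comm_ring_1 \<Rightarrow> 'a \<Rightarrow> step list \<Rightarrow> 'a" where
  "tiling_sum q t w = (\<Sum>D\<in>sym_dyck_tilings (length w) (w @ mirror w). weight q t (length w) D)"

lemma sum_split_by_tile:
  "(\<Sum>D\<in>sym_dyck_tilings n \<mu>. g D) =
     (\<Sum>D\<in>{D \<in> sym_dyck_tilings n \<mu>. \<eta> \<in> D}. g D) + (\<Sum>D\<in>{D \<in> sym_dyck_tilings n \<mu>. \<eta> \<notin> D}. g D)"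
proof -
  have "sym_dyck_tilings n \<mu> = {D \<in> sym_dyck_tilings n \<mu>. \<eta> \<in> D} \<union> {D \<in> sym_dyck_tilings n \<mu>. \<eta> \<notin> D}"
    by blast
  then have "(\<Sum>D\<in>sym_dyck_tilings n \<mu>. g D) =
      (\<Sum>D\<in>{D \<in> sym_dyck_tilings n \<mu>. \<eta> \<in> D} \<union> {D \<in> sym_dyck_tilings n \<mu>. \<eta> \<notin> D}. g D)"
    by (rule arg_cong)
  also have "\<dots> = (\<Sum>D\<in>{D \<in> sym_dyck_tilings n \<mu>. \<eta> \<in> D}. g D) + (\<Sum>D\<in>{D \<in> sym_dyck_tilings n \<mu>. \<eta> \<notin> D}. g D)"
    by (rule sum.union_disjoint) (auto simp: finite_sym_dyck_tilings)
  finally show ?thesis .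
qed

text \<open>The two summands are the tilings in which the cells below the peak and its mirror image
  are tiles, and those in which they are not. Removing the two tiles costs one factor \<open>q\<close>, as only
  the left one is counted; contracting keeps all tiles.\<close>

lemma tiling_sum_peak:
  "tiling_sum q t (x @ Up # Down # y) = q * tiling_sum q t (x @ Down # Up # y) + tiling_sum q t (x @ y)"
proof -
  define z where "z = y @ mirror y"
  define n where "n = length x + length y"
  let ?n = "Suc (Suc n)"
  let ?l = "peak_cell x" and ?r = "peak_cell (x @ Up # Down # z)"
  let ?\<mu> = "x @ Up # Down # z @ Up # Down # mirror x"
  let ?\<mu>' = "x @ Down # Up # z @ Down # Up # mirror x"
  have z: "mirror z = z" by (simp add: z_def)
  have nz: "2 * n = 2 * length x + length z" by (simp add: z_def n_def)
  have "(\<Sum>D\<in>{D \<in> sym_dyck_tilings ?n ?\<mu>. {?l} \<in> D}. weight q t ?n D) =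
      (\<Sum>D\<in>sym_dyck_tilings ?n ?\<mu>'. weight q t ?n (insert {?l} (insert {?r} D)))"
    by (rule sum.reindex_bij_betw[OF bij_betw_remove_peak_pair(1)[OF z], symmetric])
  also have "\<dots> = (\<Sum>D\<in>sym_dyck_tilings ?n ?\<mu>'. q * weight q t ?n D)"
  proof (rule sum.cong[OF refl])
    fix D assume "D \<in> sym_dyck_tilings ?n ?\<mu>'"
    note D = bij_betw_remove_peak_pair(2)[OF z this]
    show "weight q t ?n (insert {?l} (insert {?r} D)) = q * weight q t ?n D"
      by (rule weight_insert_pair) (use D in \<open>simp_all add: content_peak_cell n_def z_def\<close>)
  qed
  finally have in': "(\<Sum>D\<in>{D \<in> sym_dyck_tilings ?n ?\<mu>. {?l} \<in> D}. weight q t ?n D) =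
      q * (\<Sum>D\<in>sym_dyck_tilings ?n ?\<mu>'. weight q t ?n D)"
    by (simp only: sum_distrib_left)
  let ?f = "contract (int (length x) - 1) \<circ> contract (int (length x + length z) + 1)"
  have "(\<Sum>D\<in>{D \<in> sym_dyck_tilings ?n ?\<mu>. {?l} \<notin> D}. weight q t ?n D) =
      (\<Sum>D\<in>sym_dyck_tilings n (x @ z @ mirror x). weight q t ?n ((-`) ?f ` D))"
    by (rule sum.reindex_bij_betw[OF bij_betw_contract_peak_pair[OF z nz], symmetric])
  also have "\<dots> = (\<Sum>D\<in>sym_dyck_tilings n (x @ z @ mirror x). weight q t n D)"
    by (simp only: weight_vimage_pair[OF nz])
  finally have out: "(\<Sum>D\<in>{D \<in> sym_dyck_tilings ?n ?\<mu>. {?l} \<notin> D}. weight q t ?n D) =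
      (\<Sum>D\<in>sym_dyck_tilings n (x @ z @ mirror x). weight q t n D)" .
  have "tiling_sum q t (x @ Up # Down # y) = (\<Sum>D\<in>sym_dyck_tilings ?n ?\<mu>. weight q t ?n D)"
    "tiling_sum q t (x @ Down # Up # y) = (\<Sum>D\<in>sym_dyck_tilings ?n ?\<mu>'. weight q t ?n D)"
    "tiling_sum q t (x @ y) = (\<Sum>D\<in>sym_dyck_tilings n (x @ z @ mirror x). weight q t n D)"
    by (simp_all add: tiling_sum_def z_def n_def)
  then show ?thesis
    using sum_split_by_tile[of "weight q t ?n" ?n ?\<mu> "{?l}"] unfolding in' out by (simp only:)
qed

text \<open>The same dichotomy at the central peak, whose cell lies on the center line and so
  has weight \<open>t * q\<close>.\<close>

lemma tiling_sum_final_Up: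
  "tiling_sum q t (x @ [Up]) = t * q * tiling_sum q t (x @ [Down]) + tiling_sum q t x"
proof -
  define n where "n = length x"
  let ?c = "peak_cell x" and ?\<mu> = "x @ Up # Down # mirror x" and ?\<mu>' = "x @ Down # Up # mirror x"
  have "(\<Sum>D\<in>{D \<in> sym_dyck_tilings (Suc n) ?\<mu>. {?c} \<in> D}. weight q t (Suc n) D) =
      (\<Sum>D\<in>sym_dyck_tilings (Suc n) ?\<mu>'. weight q t (Suc n) (insert {?c} D))"
    by (rule sum.reindex_bij_betw[OF bij_betw_remove_center_peak(1), symmetric])
  also have "\<dots> = (\<Sum>D\<in>sym_dyck_tilings (Suc n) ?\<mu>'. t * q * weight q t (Suc n) D)"
  proof (rule sum.cong[OF refl])
    fix D assume "D \<in> sym_dyck_tilings (Suc n) ?\<mu>'"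
    note D = bij_betw_remove_center_peak(2)[OF this]
    show "weight q t (Suc n) (insert {?c} D) = t * q * weight q t (Suc n) D"
      by (rule weight_insert_center) (use D in \<open>simp_all add: content_peak_cell n_def\<close>)
  qed
  finally have in': "(\<Sum>D\<in>{D \<in> sym_dyck_tilings (Suc n) ?\<mu>. {?c} \<in> D}. weight q t (Suc n) D) =
      t * q * (\<Sum>D\<in>sym_dyck_tilings (Suc n) ?\<mu>'. weight q t (Suc n) D)"
    by (simp only: sum_distrib_left)
  have "(\<Sum>D\<in>{D \<in> sym_dyck_tilings (Suc n) ?\<mu>. {?c} \<notin> D}. weight q t (Suc n) D) =
      (\<Sum>D\<in>sym_dyck_tilings n (x @ mirror x). weight q t (Suc n) ((-`) (contract (int n - 1)) ` D))"
    unfolding n_def by (rule sum.reindex_bij_betw[OF bij_betw_contract_center_peak, symmetric])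
  also have "\<dots> = (\<Sum>D\<in>sym_dyck_tilings n (x @ mirror x). weight q t n D)"
    by (simp only: weight_vimage_center)
  finally have out: "(\<Sum>D\<in>{D \<in> sym_dyck_tilings (Suc n) ?\<mu>. {?c} \<notin> D}. weight q t (Suc n) D) =
      (\<Sum>D\<in>sym_dyck_tilings n (x @ mirror x). weight q t n D)" .
  have "tiling_sum q t (x @ [Up]) = (\<Sum>D\<in>sym_dyck_tilings (Suc n) ?\<mu>. weight q t (Suc n) D)"
    "tiling_sum q t (x @ [Down]) = (\<Sum>D\<in>sym_dyck_tilings (Suc n) ?\<mu>'. weight q t (Suc n) D)"
    "tiling_sum q t x = (\<Sum>D\<in>sym_dyck_tilings n (x @ mirror x). weight q t n D)"
    by (simp_all add: tiling_sum_def n_def)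
  then show ?thesis
    using sum_split_by_tile[of "weight q t (Suc n)" "Suc n" ?\<mu> "{?c}"] unfolding in' out by (simp only:)
qed

lemma tiling_sum_Nil: "tiling_sum q t [] = 1"
proof -
  have "D \<in> sym_dyck_tilings 0 [] \<longleftrightarrow> D = {}" for D
  proof
    assume "D \<in> sym_dyck_tilings 0 []"
    then obtain lam where "dyck_tiling 0 lam [] D"
      by (rule sym_dyck_tilingsE) simp
    then have "partition_on (region lam []) D" by (simp add: dyck_tiling_def)
    moreover have "region lam [] = {}" by (auto simp: region_def)
    ultimately show "D = {}" by (simp add: partition_on_empty)
  next
    assume D: "D = {}"
    have "dyck_path 0 []" by (simp add: dyck_path_def pt_def)
    moreover have "region [] [] = {}" by (auto simp: region_def)
    ultimately have "dyck_tiling 0 [] [] D"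
      by (simp add: D dyck_tiling_def partition_on_empty weakly_above_def)
    then show "D \<in> sym_dyck_tilings 0 []" by (intro sym_dyck_tilingsI[of "[]"]) (simp_all add: D)
  qed
  then have "sym_dyck_tilings 0 [] = {{}}" by blast
  then show ?thesis by (simp add: tiling_sum_def weight_def tiles_plus_def tiles_zero_def)
qed

lemma tiling_sum_Down: "tiling_sum q t (Down # w) = 0"
proof -
  have "\<not> dyck_path n (Down # v)" for n v
  proof
    assume *: "dyck_path n (Down # v)"
    then have "1 \<le> 2 * int n" by (auto simp: dyck_path_iff)
    then have "1 \<le> 2 * ups (Down # v) 1" using * unfolding dyck_path_iff by auto
    then show False by (simp add: ups_Cons)
  qed
  then have "sym_dyck_tilings n (Down # v) = {}" for n v
    by (auto simp: sym_dyck_tilings_def sym_dyck_tiling_def dyck_tiling_def)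
  then show ?thesis by (simp add: tiling_sum_def)
qed

text \<open>The right-hand side of the theorem, for a path started at height \<open>h\<close>: a matched up step of
  height \<open>h\<close> corresponds to a down step that starts at height \<open>h\<close>, and the unmatched ones are counted
  by the final height. A down step at height 0 contributes the factor \<open>qint q 0 = 0\<close>, which
  agrees with the absence of tilings.\<close>

fun prefix_weight :: "'a::comm_ring_1 \<Rightarrow> 'a \<Rightarrow> nat \<Rightarrow> step list \<Rightarrow> 'a" where
  "prefix_weight q t h [] = fk h q t"
| "prefix_weight q t h (Up # w) = prefix_weight q t (Suc h) w"
| "prefix_weight q t h (Down # w) = qint q h * prefix_weight q t (h - 1) w"

lemma qint_0: "qint q 0 = 0" and qint_Suc: "qint q (Suc h) = 1 + q * qint q h"
  by (simp_all add: qint_def sum.lessThan_Suc_shift sum_distrib_left del: sum.lessThan_Suc)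

text \<open>This is the identity \<open>[h + 1] = q [h] + 1\<close>.\<close>

lemma prefix_weight_peak:
  "prefix_weight q t h (x @ Up # Down # y) =
     q * prefix_weight q t h (x @ Down # Up # y) + prefix_weight q t h (x @ y)"
proof (induction q t h x rule: prefix_weight.induct)
  case (1 q t h)
  show ?case by (cases h) (simp_all add: qint_0 qint_Suc algebra_simps)
qed (simp_all add: algebra_simps)

text \<open>This is the recurrence defining \<open>fk\<close>.\<close>

lemma prefix_weight_final_Up:
  "prefix_weight q t h (x @ [Up]) = t * q * prefix_weight q t h (x @ [Down]) + prefix_weight q t h x"
proof (induction q t h x rule: prefix_weight.induct)
  case (1 q t h)
  show ?case by (cases h) (simp_all add: qint_0 algebra_simps)
qed (simp_all add: algebra_simps)

text \<open>A termination measure: an up step counts more the earlier it occurs, so moving it to the right,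
  replacing it by a down step or deleting it decreases the total.\<close>

fun up_weight :: "step list \<Rightarrow> nat" where
  "up_weight [] = 0"
| "up_weight (s # w) = (if s = Up then Suc (length w) else 0) + up_weight w"

lemma up_weight_decreases:
  "up_weight (x @ Down # Up # y) < up_weight (x @ Up # Down # y)"
  "up_weight (x @ y) < up_weight (x @ Up # Down # y)"
  "up_weight (x @ [Down]) < up_weight (x @ [Up])"
  "up_weight x < up_weight (x @ [Up])"
  by (induction x) auto

text \<open>Every word that contains an up step either ends with one or contains a peak, so the common
  recurrences determine both sides from the words without up steps.\<close>

lemma tiling_sum_eq_prefix_weight: "tiling_sum q t w = prefix_weight q t 0 w"
proof (induction w rule: measure_induct_rule[of up_weight])
  case (less w)
  show ?case
  proof (cases "Up \<in> set w")
    case True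
    \<comment> \<open>Choosing the last up step makes it the final step or the beginning of a peak.\<close>
    then obtain x y where w: "w = x @ Up # y" "Up \<notin> set y" by (metis split_list_last)
    show ?thesis
    proof (cases y)
      case Nil
      then show ?thesis
        using less[of "x @ [Down]"] less[of x] up_weight_decreases(3,4)[of x]
        by (simp add: w tiling_sum_final_Up prefix_weight_final_Up)
    next
      case (Cons s y')
      then have "s = Down" using w(2) by (cases s) auto
      then show ?thesis
        using less[of "x @ Down # Up # y'"] less[of "x @ y'"] up_weight_decreases(1,2)[of x y'] Cons
        by (simp add: w tiling_sum_peak prefix_weight_peak)
    qed
  next
    case False
    show ?thesis
    proof (cases w)
      case Nil
      then show ?thesis by (simp add: tiling_sum_Nil)
    next
      case (Cons s w')
      then have "s = Down" using False by (cases s) auto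
      then show ?thesis by (simp add: Cons tiling_sum_Down qint_0)
    qed
  qed
qed

section \<open>Matched up steps\<close>

definition height :: "step list \<Rightarrow> nat \<Rightarrow> int" where
  "height w i = 2 * ups w (int i) - int i"

lemma height_0 [simp]: "height w 0 = 0"
  by (simp add: height_def)

lemma height_Suc:
  "i < length w \<Longrightarrow> height w (Suc i) = height w i + (if w ! i = Up then 1 else -1)"
  using ups_step[of "int i" w] by (simp add: height_def add.commute)

lemma ht_height: "i \<le> length w \<Longrightarrow> ht w i = nat (height w i + 1)"
  by (simp add: ht_def height_def pt_ups)

lemma dyck_path_height:
  "dyck_path n w \<longleftrightarrow> length w = 2 * n \<and> height w (2 * n) = 0 \<and> (\<forall>i\<le>2 * n. 0 \<le> height w i)"
proof (cases "length w = 2 * n")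
  case True
  then show ?thesis
    by (auto simp: dyck_path_def pt_ups height_def)
qed (simp add: dyck_path_def)

text \<open>The steps strictly between form a Dyck path iff the path returns to the level reached after the
  up step without going below it in between.\<close>

lemma matching_steps_iff:
  "matching_steps w i j \<longleftrightarrow> i < j \<and> j < length w \<and> w ! i = Up \<and> w ! j = Down \<and>
     height w j = height w (Suc i) \<and> (\<forall>k. i < k \<and> k \<le> j \<longrightarrow> height w (Suc i) \<le> height w k)"
proof (cases "i < j \<and> j < length w")
  case True
  define v where "v = take (j - Suc i) (drop (Suc i) w)"
  have "j - Suc i \<le> length w - Suc i" using True by (intro diff_le_mono) simp
  then have len: "length v = j - Suc i" by (simp add: v_def)
  have h: "height v k = height w (Suc i + k) - height w (Suc i)" if "k \<le> j - Suc i" for k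
  proof -
    have "take k v = take k (drop (Suc i) w)" using that by (simp add: v_def)
    moreover have "take (Suc i + k) w = take (Suc i) w @ take k (drop (Suc i) w)" by (rule take_add)
    ultimately have "count_list (take (Suc i + k) w) Up = count_list (take (Suc i) w) Up + count_list (take k v) Up"
      by simp
    then show ?thesis unfolding height_def ups_def nat_int by simp
  qed
  have "(\<exists>m. dyck_path m v) \<longleftrightarrow>
      height v (j - Suc i) = 0 \<and> (\<forall>k\<le>j - Suc i. 0 \<le> height v k)" (is "_ \<longleftrightarrow> ?H")
  proof
    assume ?H
    then have "2 * ups v (int (j - Suc i)) = int (j - Suc i)" by (simp add: height_def)
    then have "even (j - Suc i)" by presburger
    then obtain m where "j - Suc i = 2 * m" by (elim evenE)
    then show "\<exists>m. dyck_path m v" using \<open>?H\<close> len unfolding dyck_path_height by metis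
  qed (metis dyck_path_height len)
  also have "\<dots> \<longleftrightarrow> height w j = height w (Suc i) \<and> (\<forall>k\<le>j - Suc i. height w (Suc i) \<le> height w (Suc i + k))"
    using h True by auto
  also have "(\<forall>k\<le>j - Suc i. height w (Suc i) \<le> height w (Suc i + k)) \<longleftrightarrow>
      (\<forall>k. i < k \<and> k \<le> j \<longrightarrow> height w (Suc i) \<le> height w k)"
  proof (intro iffI allI impI)
    fix k assume *: "\<forall>k\<le>j - Suc i. height w (Suc i) \<le> height w (Suc i + k)" "i < k \<and> k \<le> j"
    then have "k - Suc i \<le> j - Suc i" "Suc i + (k - Suc i) = k" by auto
    then show "height w (Suc i) \<le> height w k" using *(1) by metis
  qed (use True in auto)
  finally show ?thesis unfolding matching_steps_def v_def[symmetric] by blast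
qed (auto simp: matching_steps_def)

lemma matching_steps_unique_Down:
  assumes "matching_steps w i j" "matching_steps w i j'"
  shows "j = j'"
proof -
  have False if "matching_steps w i j" "matching_steps w i j'" "j < j'" for j j'
  proof -
    have "height w (Suc j) = height w (Suc i) - 1"
      using that(1) height_Suc[of j w] by (simp add: matching_steps_iff)
    moreover have "height w (Suc i) \<le> height w (Suc j)"
      using that by (simp add: matching_steps_iff)
    ultimately show False by simp
  qed
  then show ?thesis using assms by (metis linorder_neqE_nat)
qed

lemma matching_steps_unique_Up:
  assumes "matching_steps w i j" "matching_steps w i' j"
  shows "i = i'"
proof -
  have False if "matching_steps w i j" "matching_steps w i' j" "i < i'" for i i'
  proof -
    have "height w (Suc i') = height w i' + 1"
      using that(2) height_Suc[of i' w] by (simp add: matching_steps_iff)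
    moreover have "height w (Suc i) \<le> height w i'" "height w (Suc i') = height w (Suc i)"
      using that by (simp_all add: matching_steps_iff)
    ultimately show False by simp
  qed
  then show ?thesis using assms by (metis linorder_neqE_nat)
qed

text \<open>The partner of a down step is the step after the last earlier point that is below its
  starting level.\<close>

lemma matching_Up_exists:
  assumes "dyck_path n w" "j < length w" "w ! j = Down"
  shows "\<exists>i. matching_steps w i j"
proof -
  have "0 \<le> height w (Suc j)" using assms by (simp add: dyck_path_height)
  then have pos: "0 < height w j" using height_Suc[of j w] assms by simp
  let ?P = "\<lambda>i. i \<le> j \<and> height w i < height w j"
  have "?P 0" using pos by simp
  then obtain i where i: "?P i" and max: "\<And>k. ?P k \<Longrightarrow> k \<le> i"
    using Nat.ex_has_greatest_nat[of ?P 0 j] by auto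
  have "i < j" using i by (cases "i = j") auto
  have above: "height w j \<le> height w k" if "i < k" "k \<le> j" for k
    using max[of k] that by (meson not_le)
  have up: "w ! i = Up" "height w (Suc i) = height w i + 1"
    using above[of "Suc i"] i height_Suc[of i w] \<open>i < j\<close> assms(2) by (auto split: if_splits)
  then have "height w (Suc i) = height w j" using above[of "Suc i"] i \<open>i < j\<close> by simp
  then have "matching_steps w i j"
    using above up \<open>i < j\<close> assms by (simp add: matching_steps_iff)
  then show ?thesis by blast
qed

lemma finite_matched_unmatched_ups [simp]: "finite (matched_ups m \<mu>)" "finite (unmatched_ups m \<mu>)"
  by (simp_all add: matched_ups_def unmatched_ups_def)

text \<open>Reading the path from left to right, an up step is at first unmatched; a down step at height
  \<open>h\<close> matches exactly one of the \<open>h\<close> unmatched up steps, and that one has height \<open>h\<close>. The suffix \<open>v\<close>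
  generalizes the claim for the induction on \<open>m\<close>, because \<open>prefix_weight\<close> recurses from
  the front.\<close>

lemma prefix_weight_take:
  assumes \<mu>: "dyck_path n \<mu>" and "m \<le> length \<mu>"
  shows "int (card (unmatched_ups m \<mu>)) = height \<mu> m \<and>
    prefix_weight q t 0 (take m \<mu> @ v) =
      (\<Prod>u\<in>matched_ups m \<mu>. qint q (ht \<mu> u)) * prefix_weight q t (card (unmatched_ups m \<mu>)) v"
  using assms(2)
proof (induction m arbitrary: v)
  case 0
  then show ?case by (simp add: matched_ups_def unmatched_ups_def)
next
  case (Suc m)
  have m: "m < length \<mu>" using Suc.prems by simp
  have card: "int (card (unmatched_ups m \<mu>)) = height \<mu> m" using Suc.IH[of v] m by simp
  have IH: "prefix_weight q t 0 (take (Suc m) \<mu> @ v) =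
      (\<Prod>u\<in>matched_ups m \<mu>. qint q (ht \<mu> u)) * prefix_weight q t (card (unmatched_ups m \<mu>)) (\<mu> ! m # v)"
    using Suc.IH[of "\<mu> ! m # v"] m by (simp add: take_Suc_conv_app_nth)
  show ?case
  proof (cases "\<mu> ! m")
    case Up
    then have no: "\<not> matching_steps \<mu> i m" for i by (simp add: matching_steps_def)
    then have "(\<exists>j<Suc m. matching_steps \<mu> i j) \<longleftrightarrow> (\<exists>j<m. matching_steps \<mu> i j)" for i
      by (metis less_Suc_eq)
    moreover have "\<not> matching_steps \<mu> m j" if "j < m" for j using that by (simp add: matching_steps_def)
    ultimately have "matched_ups (Suc m) \<mu> = matched_ups m \<mu>"
      and un: "unmatched_ups (Suc m) \<mu> = insert m (unmatched_ups m \<mu>)"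
      using Up by (auto simp: matched_ups_def unmatched_ups_def less_Suc_eq)
    moreover have "card (unmatched_ups (Suc m) \<mu>) = Suc (card (unmatched_ups m \<mu>))"
      unfolding un by (subst card_insert_disjoint) (simp_all add: unmatched_ups_def)
    ultimately show ?thesis using card IH Up height_Suc[OF m] by simp
  next
    case Down
    obtain i where i: "matching_steps \<mu> i m" using matching_Up_exists[OF \<mu> m Down] by blast
    then have im: "i < m" "\<mu> ! i = Up" "height \<mu> m = height \<mu> (Suc i)"
      by (simp_all add: matching_steps_iff)
    have matching: "(\<exists>j<Suc m. matching_steps \<mu> k j) \<longleftrightarrow> k = i \<or> (\<exists>j<m. matching_steps \<mu> k j)" for k
      using i matching_steps_unique_Up[OF i] by (metis less_Suc_eq)
    have i': "\<not> (\<exists>j<m. matching_steps \<mu> i j)"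
      using matching_steps_unique_Down[OF i] by blast
    have mat: "matched_ups (Suc m) \<mu> = insert i (matched_ups m \<mu>)" "i \<notin> matched_ups m \<mu>"
      and un: "unmatched_ups (Suc m) \<mu> = unmatched_ups m \<mu> - {i}" "i \<in> unmatched_ups m \<mu>"
      using im i' Down unfolding matched_ups_def unmatched_ups_def matching
      by (auto simp: less_Suc_eq)
    have "height \<mu> m = height \<mu> i + 1" using im height_Suc[of i \<mu>] m by simp
    then have "ht \<mu> i = card (unmatched_ups m \<mu>)" using card ht_height[of i \<mu>] im m by simp
    moreover have "card (unmatched_ups (Suc m) \<mu>) = card (unmatched_ups m \<mu>) - 1"
      unfolding un(1) using un(2) by simp
    moreover have "0 < card (unmatched_ups m \<mu>)" using un(2) by (auto simp: card_gt_0_iff)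
    ultimately show ?thesis
      using card IH Down height_Suc[OF m] mat by (simp add: algebra_simps)
  qed
qed

theorem corollary7p2:
  fixes n k :: nat and \<mu> :: "step list" and q t :: "'a::comm_ring_1"
  assumes "sym_dyck_path n \<mu>"
    and "card (unmatched_ups n \<mu>) = k"
  shows "(\<Sum>D\<in>sym_dyck_tilings n \<mu>. q ^ (tiles_plus n D + tiles_zero n D) * t ^ tiles_zero n D) =
    fk k q t * (\<Prod>u\<in>matched_ups n \<mu>. qint q (ht \<mu> u))"
proof -
  have \<mu>: "dyck_path n \<mu>" "mirror \<mu> = \<mu>" using assms(1) by (simp_all add: sym_dyck_path_iff)
  define w where "w = take n \<mu>"
  have len: "length \<mu> = 2 * n" using \<mu>(1) by (simp add: dyck_path_def)
  then have "length w = n" "length (drop n \<mu>) = length w" by (simp_all add: w_def)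
  then have "drop n \<mu> = mirror w"
    using mirror_append_eq[of "drop n \<mu>" w "[]"] \<mu>(2) by (simp add: w_def)
  then have "\<mu> = w @ mirror w"
    unfolding w_def by (metis append_take_drop_id)
  then have "(\<Sum>D\<in>sym_dyck_tilings n \<mu>. q ^ (tiles_plus n D + tiles_zero n D) * t ^ tiles_zero n D)
      = tiling_sum q t w"
    using \<open>length w = n\<close> by (simp add: tiling_sum_def weight_def)
  also have "\<dots> = prefix_weight q t 0 w" by (rule tiling_sum_eq_prefix_weight)
  also have "\<dots> = fk k q t * (\<Prod>u\<in>matched_ups n \<mu>. qint q (ht \<mu> u))"
    using prefix_weight_take[OF \<mu>(1), of n q t "[]"] assms(2) len by (simp add: w_def mult.commute)
  finally show ?thesis .
qed

end
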